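(* Let $\mu$ be an infinitely divisible distribution on $\mathbb{R}_+$ (with zero drift $\gamma_0=0$) with absolutely continuous Lévy measure $\nu(dx)=g(x)\,dx$ satisfying $\nu((0,1))=\infty$, and suppose $\nu((c,\infty))>0$ for all $c>0$. Let $g_1(x)$ be a density of $\nu_{(1)}$. Let $f_1(x)$ be a density of the infinitely divisible distribution on $\mathbb{R}_+$ (with zero drift) with Lévy measure $1_{(0,1)}(x)\nu(dx)$. Assume that for some $b_0>0$ $$\lim_{x\to\infty}\exp(b_0x)f_1(x)=0$$ and that $g_1(x)$ is bounded and $g_1\in\mathcal{L}_d$. Then we can choose a density $p(x)$ of $\mu$ such that the following are equivalent: (1) $p\in\mathcal{S}_d$. (2) $g_1\in\mathcal{S}_d$. (3) $p(x)\sim C_0\,g_1(x)$ with $C_0:=\int_1^\infty g(x)\,dx$. (4) There is $C\in(0,\infty)$ such that $p(x)\sim C g_1(x)$.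
   Context: $\mathbb{R}_+=[0,\infty)$. For functions $f,h$ that are positive on some half line $[A,\infty)$, $f(x)\sim h(x)$ means $\lim_{x\to\infty}f(x)/h(x)=1$. A nonnegative measurable function $h$ on $\mathbb{R}$ belongs to the class $\mathbf{L}$ (long-tailed) if $h(x+a)\sim h(x)$ for every $a\in\mathbb{R}$. For probability densities $f,h$ on $\mathbb{R}$, $f\otimes h(x)=\int_{-\infty}^{\infty} f(x-u)h(u)\,du$ and $f^{2\otimes}=f\otimes f$. Densities of distributions on $\mathbb{R}_+$ are regarded as functions on $\mathbb{R}$ vanishing on $(-\infty,0)$. A probability density $h$ on $\mathbb{R}$ belongs to $\mathcal{L}_d$ if $h\in\mathbf{L}$; it belongs to $\mathcal{S}_d$ (subexponential density) if $h\in\mathcal{L}_d$ and $h^{2\otimes}(x)\sim 2h(x)$. An infinitely divisible distribution $\mu$ on $\mathbb{R}_+$ has characteristic function $\widehat\mu(z)=\int e^{izx}\mu(dx)=\exp\left(\int_0^\infty(e^{izx}-1)\nu(dx)+i\gamma_0z\right)$, where $\gamma_0\in\mathbb{R}_+$ is the drift and the Lévy measure $\nu$ is a measure on $\mathbb{R}_+$ with $\nu(\{0\})=0$ and $\int_0^\infty(1\wedge x)\nu(dx)<\infty$. The normalized Lévy measure is the probability distribution $\nu_{(1)}(dx):=1_{(1,\infty)}(x)\,\nu(dx)/\nu((1,\infty))$. When the Lévy measure is absolutely continuous with infinite mass on $(0,1)$, the infinitely divisible distribution is absolutely continuous, so the densities $f_1$ and $p$ exist. *)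

theory Defs
  imports "HOL-Probability.Probability"
begin

text \<open>Positivity on a half line is part of the relation, so no quotient below is affected by
  the convention \<open>x / 0 = 0\<close>.\<close>

definition tail_equiv :: "(real \<Rightarrow> real) \<Rightarrow> (real \<Rightarrow> real) \<Rightarrow> bool" where
  "tail_equiv f h \<longleftrightarrow>
     (\<exists>A. \<forall>x\<ge>A. f x > 0 \<and> h x > 0) \<and> ((\<lambda>x. f x / h x) \<longlongrightarrow> 1) at_top"

definition long_tailed :: "(real \<Rightarrow> real) \<Rightarrow> bool" where
  "long_tailed h \<longleftrightarrow> h \<in> borel_measurable borel \<and> (\<forall>x. h x \<ge> 0) \<and>
     (\<forall>a. tail_equiv (\<lambda>x. h (x + a)) h)"

definition is_density_of :: "(real \<Rightarrow> real) \<Rightarrow> real measure \<Rightarrow> bool" where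
  "is_density_of h M \<longleftrightarrow> h \<in> borel_measurable borel \<and> (\<forall>x. h x \<ge> 0) \<and>
     M = density lborel (\<lambda>x. ennreal (h x))"

definition prob_density :: "(real \<Rightarrow> real) \<Rightarrow> bool" where
  "prob_density h \<longleftrightarrow> (\<exists>M. prob_space M \<and> is_density_of h M)"

definition is_density_on_Rplus_of :: "(real \<Rightarrow> real) \<Rightarrow> real measure \<Rightarrow> bool" where
  "is_density_on_Rplus_of h M \<longleftrightarrow> is_density_of h M \<and> (\<forall>x<0. h x = 0)"

text \<open>Where the convolution integral diverges, the Bochner integral returns 0. This cannot
  create a false tail equivalence, because \<^const>\<open>tail_equiv\<close> requires positivity.\<close>

definition density_conv :: "(real \<Rightarrow> real) \<Rightarrow> (real \<Rightarrow> real) \<Rightarrow> real \<Rightarrow> real" where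
  "density_conv f h x = (LBINT u. f (x - u) * h u)"

definition long_tailed_density :: "(real \<Rightarrow> real) \<Rightarrow> bool" where
  "long_tailed_density h \<longleftrightarrow> prob_density h \<and> long_tailed h"

definition subexp_density :: "(real \<Rightarrow> real) \<Rightarrow> bool" where
  "subexp_density h \<longleftrightarrow> long_tailed_density h \<and> tail_equiv (density_conv h h) (\<lambda>x. 2 * h x)"

definition infinitely_divisible :: "real measure \<Rightarrow> bool" where
  "infinitely_divisible M \<longleftrightarrow> real_distribution M \<and>
     (\<forall>n\<ge>1. \<exists>N. real_distribution N \<and> M = ((\<lambda>K. convolution N K) ^^ n) (return borel 0))"

text \<open>A measure on the half line \<open>[0, \<infinity>)\<close> is represented by a Borel measure on the real line
  that does not charge the negative numbers; for a Levy measure, 0 is not charged either.\<close>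

definition levy_measure_Rplus :: "real measure \<Rightarrow> bool" where
  "levy_measure_Rplus \<nu> \<longleftrightarrow> sets \<nu> = sets borel \<and> emeasure \<nu> {..0} = 0 \<and>
     (\<integral>\<^sup>+ x. ennreal (min 1 x) \<partial>\<nu>) < \<infinity>"

definition inf_div_Rplus :: "real measure \<Rightarrow> real \<Rightarrow> real measure \<Rightarrow> bool" where
  "inf_div_Rplus \<mu> \<gamma>\<^sub>0 \<nu> \<longleftrightarrow>
     infinitely_divisible \<mu> \<and> emeasure \<mu> {..<0} = 0 \<and> \<gamma>\<^sub>0 \<ge> 0 \<and> levy_measure_Rplus \<nu> \<and>
     (\<forall>z. char \<mu> z =
        exp ((CLINT x|\<nu>. iexp (z * x) - 1) + \<i> * complex_of_real \<gamma>\<^sub>0 * complex_of_real z))"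

definition restricted_measure :: "real measure \<Rightarrow> real set \<Rightarrow> real measure" where
  "restricted_measure \<nu> B = density \<nu> (indicator B)"

definition normalized_levy_measure :: "real measure \<Rightarrow> real measure" where
  "normalized_levy_measure \<nu> =
     density \<nu> (\<lambda>x. indicator {1<..} x / emeasure \<nu> {1<..})"

end

theory Submission
  imports Defs
begin

text \<open>Split the Levy measure at 1. The jumps that exceed 1 form a compound Poisson variable with
  intensity \<open>l = \<nu>((1, \<infinity>))\<close> and jump density \<open>g\<^sub>1\<close>, and the remaining part of the law is \<open>\<mu>\<^sub>1\<close>.
  Hence the mixture \<open>p\<close> of the convolutions \<open>f\<^sub>1 \<otimes> g\<^sub>1 \<otimes> \<dots> \<otimes> g\<^sub>1\<close> with \<open>n\<close> factors \<open>g\<^sub>1\<close>, taken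
  with the Poisson weights \<open>exp (- l) * l ^ n / fact n\<close>, is a density of \<open>\<mu>\<close>, as the
  characteristic functions show (lemmas \<open>char_poisson_mixture\<close> and \<open>levy_exponent_split\<close>); the
  series converges everywhere because \<open>g\<^sub>1\<close> is bounded. It remains to understand the tail of
  such a mixture.

  A long-tailed function is asymptotically constant on intervals of bounded length, uniformly
  (lemma \<open>long_tailed_uniform\<close>). Therefore, in a convolution at a large point \<open>x\<close>, the ends of
  the range of integration, where one of the two arguments is bounded, contribute what they
  should: one copy of the tail of each factor. So the \<open>n\<close>-fold term is asymptotically at least
  \<open>n * g\<^sub>1\<close>, and \<open>liminf p / g\<^sub>1 \<ge> l\<close>. Subexponentiality of a long-tailed density \<open>q\<close> means
  precisely that the middle of its self-convolution is negligible (\<open>mid_small q\<close>).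

  From a subexponential density \<open>q\<close> with \<open>g\<^sub>1 = O(q)\<close> one gets \<open>p \<le> l * g\<^sub>1 + o(q)\<close> (lemma
  \<open>poisson_mixture_asymp_le\<close>), because middle parts are negligible on the scale \<open>q\<close> and the
  \<open>n\<close>-fold terms grow at most geometrically on that scale. With \<open>q = g\<^sub>1\<close> this gives \<open>p \<sim> l *
  g\<^sub>1\<close> if \<open>g\<^sub>1\<close> is subexponential, and with \<open>q = p\<close> it gives \<open>p \<sim> l * g\<^sub>1\<close> if \<open>p\<close> is
  subexponential. The negligible middle is inherited under tail equivalence, so \<open>p\<close> is
  subexponential if \<open>g\<^sub>1\<close> is.

  The remaining point is that \<open>g\<^sub>1\<close> is subexponential if \<open>p \<sim> C * g\<^sub>1\<close> for some \<open>C > 0\<close>. Here \<open>C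
  \<ge> l\<close> by the above, and the question is why \<open>C > l\<close> is impossible. Weight both densities with
  \<open>exp (e * min x T)\<close>. This weight is submultiplicative; since \<open>g\<^sub>1\<close> has no exponential moments,
  \<open>T\<close> can be chosen, however small \<open>e\<close> is, such that the weight raises the mass of \<open>g\<^sub>1\<close> from 1
  to about \<open>1 + \<delta>\<close>. It then raises the mass of \<open>p\<close> by about \<open>C * \<delta>\<close>, as for small \<open>e\<close> only the
  far tail matters, but also by at most about \<open>exp (l * \<delta>) - 1\<close>, by submultiplicativity. Hence
  \<open>C \<le> l\<close> (lemma \<open>poisson_mixture_ratio_le\<close>). Then no term of the series can exceed its lower
  bound asymptotically; for \<open>n = 2\<close> this forces the middle part of \<open>g\<^sub>1 \<otimes> g\<^sub>1\<close> to be negligible.\<close>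

section \<open>Uniformity in long-tailed functions\<close>

text \<open>The uniform convergence theorem for slowly varying functions, in additive form. Pointwise
  convergence of the increments gives, by dominated convergence, that the increment from \<open>x\<close>,
  capped at 1 and averaged over \<open>[0, 2T]\<close>, tends to 0. An increment \<open>k (x + a) - k x\<close> that stays
  away from 0 would contradict this at \<open>x\<close> or at \<open>x + a\<close>. Measurability of \<open>k\<close> is essential
  here.\<close>

lemma log_increment_tendsto_uniformly:
  fixes k :: "real \<Rightarrow> real"
  assumes k [measurable]: "k \<in> borel_measurable borel"
    and lim: "\<And>a. ((\<lambda>x. k (x + a) - k x) \<longlongrightarrow> 0) at_top"
    and T: "T > 0" and e: "e > 0"
  shows "\<forall>\<^sub>F x in at_top. \<forall>a\<in>{0..T}. \<bar>k (x + a) - k x\<bar> < e"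
proof -
  define J where
    "J x = (LINT b|lborel. indicator {0..2*T} b * min 1 \<bar>k (x + b) - k x\<bar>)" for x
  define m where "m = T * min 1 e / 2"
  have m: "m > 0" using T e by (simp add: m_def)
  have int: "integrable lborel (\<lambda>b. indicator {0..2*T} b * min 1 \<bar>k (x + b) - k (x + c)\<bar>)" for x c
    by (rule Bochner_Integration.integrable_bound[where f = "indicator {0..2*T} :: real \<Rightarrow> real"])
       (auto intro!: integrable_real_indicator simp: emeasure_lborel_Icc_eq split: split_indicator)
  have "(J \<longlongrightarrow> (LINT b::real|lborel. (0::real))) at_top"
    unfolding J_def
  proof (rule integral_dominated_convergence_at_top[where w = "indicator {0..2*T} :: real \<Rightarrow> real"])
    show "AE b in lborel. ((\<lambda>x. indicator {0..2*T} b * min 1 \<bar>k (x + b) - k x\<bar>) \<longlongrightarrow> 0) at_top"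
    proof (rule AE_I2)
      fix b
      have "((\<lambda>x. indicator {0..2*T} b * min 1 \<bar>k (x + b) - k x\<bar>)
              \<longlongrightarrow> indicator {0..2*T} b * min 1 \<bar>0\<bar>) at_top"
        by (intro tendsto_intros lim)
      then show "((\<lambda>x. indicator {0..2*T} b * min 1 \<bar>k (x + b) - k x\<bar>) \<longlongrightarrow> 0) at_top" by simp
    qed
    show "\<forall>\<^sub>F i in at_top. AE x in lborel.
       norm (indicator {0..2*T} x * min 1 \<bar>k (i + x) - k i\<bar>) \<le> (indicator {0..2*T} x :: real)"
      by (auto simp: indicator_def)
  qed (auto intro!: integrable_real_indicator simp: emeasure_lborel_Icc_eq)
  then have "(J \<longlongrightarrow> 0) at_top" by simp
  then have "\<forall>\<^sub>F x in at_top. J x < m"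
    using m by (rule order_tendstoD(2))
  then obtain X where X: "\<And>x. x \<ge> X \<Longrightarrow> J x < m"
    by (auto simp: eventually_at_top_linorder)
  show ?thesis
  proof (rule eventually_at_top_linorderI[of X], rule ballI)
    fix x a assume x: "X \<le> x" and a: "a \<in> {0..T}"
    define d where "d = min 1 \<bar>k (x + a) - k x\<bar>"
    \<comment> \<open>Every base point \<open>x + b\<close> with \<open>b\<close> in \<open>[T, 2T]\<close> is reached both from \<open>x\<close> and from \<open>x + a\<close>,
      so one of the two increments has to carry its share of the distance.\<close>
    have "T * d = (LINT b|lborel. indicator {T..2*T} b * d)"
      using T by simp
    also have "\<dots> \<le> (LINT b|lborel. indicator {0..2*T} b * min 1 \<bar>k (x + b) - k x\<bar>
           + indicator {0..2*T} (b - a) * min 1 \<bar>k (x + a + (b - a)) - k (x + a)\<bar>)"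
    proof (rule integral_mono)
      show "integrable lborel (\<lambda>b. indicator {T..2*T} b * d)"
        by (intro integrable_mult_left integrable_real_indicator)
           (auto simp: emeasure_lborel_Icc_eq)
      show "integrable lborel (\<lambda>b. indicator {0..2*T} b * min 1 \<bar>k (x + b) - k x\<bar>
           + indicator {0..2*T} (b - a) * min 1 \<bar>k (x + a + (b - a)) - k (x + a)\<bar>)"
        using int[of x 0] lborel_integrable_real_affine[OF int[of "x + a" 0], of 1 "-a"]
        by (intro Bochner_Integration.integrable_add) (simp_all add: algebra_simps)
      fix b :: real
      show "indicator {T..2*T} b * d \<le> indicator {0..2*T} b * min 1 \<bar>k (x + b) - k x\<bar>
           + indicator {0..2*T} (b - a) * min 1 \<bar>k (x + a + (b - a)) - k (x + a)\<bar>"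
        using a T by (auto simp: indicator_def d_def)
    qed
    also have "\<dots> = J x + (LINT b|lborel. indicator {0..2*T} (b - a) *
          min 1 \<bar>k (x + a + (b - a)) - k (x + a)\<bar>)"
      unfolding J_def
      using int[of x 0] lborel_integrable_real_affine[OF int[of "x + a" 0], of 1 "-a"]
      by (intro Bochner_Integration.integral_add) (simp_all add: algebra_simps)
    also have "(LINT b|lborel. indicator {0..2*T} (b - a) *
          min 1 \<bar>k (x + a + (b - a)) - k (x + a)\<bar>) = J (x + a)"
      unfolding J_def
      by (subst lborel_integral_real_affine[where c = 1 and t = "-a"]) auto
    also have "J x + J (x + a) < 2 * m"
      using X[of x] X[of "x + a"] x a by simp
    finally have "T * d < T * min 1 e" by (simp add: m_def)
    then have "d < min 1 e" using T by simp
    then show "\<bar>k (x + a) - k x\<bar> < e" unfolding d_def by linarith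
  qed
qed

lemma long_tailedD:
  assumes "long_tailed h"
  shows "h \<in> borel_measurable borel" "h x \<ge> 0" "\<forall>\<^sub>F x in at_top. h x > 0"
  using assms unfolding long_tailed_def tail_equiv_def eventually_at_top_linorder by fastforce+

text \<open>Long-tailedness is only a pointwise condition on the shift, but a convolution integral
  uses all shifts in an interval at once. The uniform convergence theorem, applied to \<open>ln \<circ> h\<close>,
  supplies this, in a multiplicative form that involves no division.\<close>

lemma long_tailed_uniform:
  assumes h: "long_tailed h" and T: "T > 0" and r: "r < 1"
  shows "\<forall>\<^sub>F x in at_top. \<forall>u\<in>{0..T}. r * h x \<le> h (x - u) \<and> r * h (x - u) \<le> h x"
proof (cases "r \<le> 0")
  case True
  then show ?thesis
    using long_tailedD(2)[OF h] by (intro always_eventually allI ballI conjI)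
      (meson mult_nonpos_nonneg order_trans)+
next
  case False
  note [measurable] = long_tailedD(1)[OF h]
  define k where "k x = ln (h x)" for x
  have k: "k \<in> borel_measurable borel" unfolding k_def by measurable
  have lim: "((\<lambda>x. k (x + a) - k x) \<longlongrightarrow> 0) at_top" for a
  proof -
    have te: "tail_equiv (\<lambda>x. h (x + a)) h" using h by (simp add: long_tailed_def)
    then have "((\<lambda>x. ln (h (x + a) / h x)) \<longlongrightarrow> ln 1) at_top"
      unfolding tail_equiv_def by (intro tendsto_ln) auto
    moreover have "\<forall>\<^sub>F x in at_top. ln (h (x + a) / h x) = k (x + a) - k x"
    proof -
      obtain A where "\<forall>x\<ge>A. h (x + a) > 0 \<and> h x > 0"
        using te by (auto simp: tail_equiv_def)
      then show ?thesis
        by (intro eventually_at_top_linorderI[of A]) (auto simp: k_def ln_div)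
    qed
    ultimately show ?thesis
      using Lim_transform_eventually by fastforce
  qed
  have e: "- ln r > 0" using r False by simp
  obtain X where X: "\<And>x a. x \<ge> X \<Longrightarrow> a \<in> {0..T} \<Longrightarrow> \<bar>k (x + a) - k x\<bar> < - ln r"
    using log_increment_tendsto_uniformly[OF k lim T e]
    unfolding eventually_at_top_linorder by blast
  obtain Y where Y: "\<And>x. x \<ge> Y \<Longrightarrow> h x > 0"
    using long_tailedD(3)[OF h] by (auto simp: eventually_at_top_linorder)
  show ?thesis
  proof (rule eventually_at_top_linorderI[of "max X Y + T"], rule ballI)
    fix x u assume x: "max X Y + T \<le> x" and u: "u \<in> {0..T}"
    have pos: "h x > 0" "h (x - u) > 0" using x u T by (auto intro!: Y)
    have *: "\<bar>k x - k (x - u)\<bar> < - ln r"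
      using X[of "x - u" u] x u by auto
    have "ln (r * h x) \<le> ln (h (x - u))" "ln (r * h (x - u)) \<le> ln (h x)"
      using * pos False by (auto simp: k_def ln_mult)
    then show "r * h x \<le> h (x - u) \<and> r * h (x - u) \<le> h x"
      using pos False by simp
  qed
qed

text \<open>Far out, a long-tailed function loses at most the factor \<open>exp (- e)\<close> per unit step, hence
  it decays more slowly than every exponential.\<close>

lemma long_tailed_lower_exp:
  assumes h: "long_tailed h" and e: "e > 0"
  shows "\<exists>c>0. \<forall>\<^sub>F x in at_top. c * exp (- e * x) \<le> h x"
proof -
  have "\<forall>\<^sub>F x in at_top. \<forall>u\<in>{0..1}. exp (-e) * h x \<le> h (x - u) \<and> exp (-e) * h (x - u) \<le> h x"
    using e by (intro long_tailed_uniform h) auto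
  then obtain X where X: "\<And>x u. x \<ge> X \<Longrightarrow> u \<in> {0..1} \<Longrightarrow> exp (-e) * h (x - u) \<le> h x"
    unfolding eventually_at_top_linorder by blast
  obtain Y where Y: "\<And>x. x \<ge> Y \<Longrightarrow> h x > 0"
    using long_tailedD(3)[OF h] by (auto simp: eventually_at_top_linorder)
  define Z where "Z = max X Y"
  have step: "exp (-e) * h Z * exp (- e * real n) \<le> h (Z + real n + a)" if "a \<in> {0..1}" for n a
    using that
  proof (induction n arbitrary: a)
    case 0
    show ?case using X[of "Z + a" a] 0 by (auto simp: Z_def)
  next
    case (Suc n)
    have "exp (-e) * h Z * exp (- e * real (Suc n)) = exp (-e) * (exp (-e) * h Z * exp (- e * real n))"
      by (simp add: algebra_simps flip: exp_add)
    also have "\<dots> \<le> exp (-e) * h (Z + real n + a)"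
      using Suc by (intro mult_left_mono) auto
    also have "\<dots> \<le> h (Z + real (Suc n) + a)"
      using X[of "Z + real (Suc n) + a" 1] Suc.prems by (auto simp: Z_def algebra_simps)
    finally show ?case .
  qed
  define c where "c = exp (-e) * h Z * exp (e * Z)"
  show ?thesis
  proof (intro exI[of _ c] conjI eventually_at_top_linorderI[of Z])
    show "c > 0" using Y[of Z] by (simp add: c_def Z_def)
    fix x assume x: "Z \<le> x"
    define n where "n = nat \<lfloor>x - Z\<rfloor>"
    have n: "real n \<le> x - Z" "x - Z < real n + 1"
      using x unfolding n_def by linarith+
    have "c * exp (- e * x) = exp (-e) * h Z * exp (- e * (x - Z))"
      by (simp add: c_def algebra_simps flip: exp_add)
    also have "\<dots> \<le> exp (-e) * h Z * exp (- e * real n)"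
      using n e Y[of Z] by (intro mult_left_mono) (auto simp: Z_def)
    also have "\<dots> \<le> h (Z + real n + (x - Z - real n))"
      by (rule step) (use n in auto)
    finally show "c * exp (- e * x) \<le> h x" by simp
  qed
qed

text \<open>The geometric bound on the convolution powers below needs one constant for all \<open>y\<close> from
  \<open>A\<close> on, and not only for \<open>y\<close> large in terms of the shift. A shift of length up to \<open>A\<close> is
  therefore made in unit steps, each of which is controlled from a point that does not depend on
  \<open>A\<close>.\<close>

lemma long_tailed_local_comparison:
  assumes h: "long_tailed h"
  shows "\<exists>A0. \<forall>A\<ge>A0. h A > 0 \<and> (\<exists>c>0. \<forall>y\<ge>A. \<forall>u\<in>{0..A}. h y \<le> c * h (y + u))"
proof -
  have "\<forall>\<^sub>F x in at_top. \<forall>u\<in>{0..1}. 1/2 * h x \<le> h (x - u) \<and> 1/2 * h (x - u) \<le> h x"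
    by (intro long_tailed_uniform h) auto
  then obtain X where X: "\<And>x u. x \<ge> X \<Longrightarrow> u \<in> {0..1} \<Longrightarrow> 1/2 * h (x - u) \<le> h x"
    unfolding eventually_at_top_linorder by blast
  obtain Y where Y: "\<And>x. x \<ge> Y \<Longrightarrow> h x > 0"
    using long_tailedD(3)[OF h] by (auto simp: eventually_at_top_linorder)
  have step: "h y \<le> 2 ^ n * h (y + u)" if "y \<ge> X" "u \<in> {0..real n}" for n y u
    using that
  proof (induction n arbitrary: u)
    case 0 then show ?case by simp
  next
    case (Suc n)
    define v where "v = min u (real n)"
    have "h y \<le> 2 ^ n * h (y + v)" using Suc by (auto simp: v_def)
    also have "h (y + v) \<le> 2 * h (y + u)"
      using X[of "y + u" "u - v"] Suc.prems by (auto simp: v_def min_def)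
    finally show ?case by simp
  qed
  show ?thesis
  proof (rule exI[of _ "max X Y"], intro allI impI conjI)
    fix A assume A: "max X Y \<le> A"
    show "h A > 0" using A Y by simp
    show "\<exists>c>0. \<forall>y\<ge>A. \<forall>u\<in>{0..A}. h y \<le> c * h (y + u)"
    proof (intro exI[of _ "2 ^ nat \<lceil>A\<rceil>"] conjI allI impI ballI)
      fix y u assume y: "y \<ge> A" and u: "u \<in> {0..A}"
      have "u \<le> real (nat \<lceil>A\<rceil>)" 
        by (meson atLeastAtMost_iff order_trans real_nat_ceiling_ge u)
      then show "h y \<le> 2 ^ nat \<lceil>A\<rceil> * h (y + u)" using u y A by (intro step) auto
    qed simp
  qed
qed

section \<open>Asymptotic bounds for convolutions on the half line\<close>

definition halfline_density :: "(real \<Rightarrow> real) \<Rightarrow> bool" where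
  "halfline_density a \<longleftrightarrow> a \<in> borel_measurable borel \<and> (\<forall>x. a x \<ge> 0) \<and> (\<forall>x<0. a x = 0) \<and>
     (\<integral>\<^sup>+ x. ennreal (a x) \<partial>lborel) = 1"

text \<open>The convolution is taken in the extended nonnegative reals because the densities need not
  be bounded, so that it may be infinite at some points.\<close>

definition conv_on :: "real set \<Rightarrow> (real \<Rightarrow> real) \<Rightarrow> (real \<Rightarrow> real) \<Rightarrow> real \<Rightarrow> ennreal" where
  "conv_on S a b x = (\<integral>\<^sup>+ u. ennreal (a (x - u) * b u) * indicator S u \<partial>lborel)"

lemma halfline_densityD:
  assumes "halfline_density a"
  shows "a \<in> borel_measurable borel" "a x \<ge> 0" "x < 0 \<Longrightarrow> a x = 0"
    "(\<integral>\<^sup>+ x. ennreal (a x) \<partial>lborel) = 1"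
  using assms by (auto simp: halfline_density_def)

lemma density_conv_eq_conv_on:
  assumes "halfline_density a" "halfline_density b"
  shows "density_conv a b x = enn2real (conv_on UNIV a b x)"
proof -
  note [measurable] = assms[THEN halfline_densityD(1)]
  show ?thesis
    unfolding density_conv_def conv_on_def using assms[THEN halfline_densityD(2)]
    by (subst integral_eq_nn_integral) auto
qed

lemma conv_on_le_cmult:
  assumes [measurable]: "a' \<in> borel_measurable borel" "b' \<in> borel_measurable borel" "S \<in> sets borel"
    and K: "K \<ge> 0" and le: "\<And>u. u \<in> S \<Longrightarrow> a (x - u) * b u \<le> K * (a' (x - u) * b' u)"
  shows "conv_on S a b x \<le> ennreal K * conv_on S a' b' x"
proof -
  have "conv_on S a b x \<le> (\<integral>\<^sup>+ u. ennreal K * (ennreal (a' (x - u) * b' u) * indicator S u) \<partial>lborel)"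
    unfolding conv_on_def
    using le K by (intro nn_integral_mono) (auto intro: ennreal_leI simp flip: ennreal_mult' split: split_indicator)
  also have "\<dots> = ennreal K * conv_on S a' b' x"
    unfolding conv_on_def by (intro nn_integral_cmult) measurable
  finally show ?thesis .
qed

lemma conv_on_le_const:
  assumes b: "halfline_density b" and K: "K \<ge> 0"
    and le: "\<And>u. u \<in> S \<Longrightarrow> 0 \<le> u \<Longrightarrow> a (x - u) \<le> K"
  shows "conv_on S a b x \<le> ennreal K"
proof -
  note [measurable] = halfline_densityD(1)[OF b]
  have "a (x - u) * b u \<le> K * b u" if "u \<in> S" for u
    using le[of u] that halfline_densityD(2,3)[OF b, of u] mult_right_mono[of "a (x-u)" K "b u"]
    by (cases "u < 0") auto
  then have "conv_on S a b x \<le> (\<integral>\<^sup>+ u. ennreal K * ennreal (b u) \<partial>lborel)"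
    unfolding conv_on_def using K
    by (intro nn_integral_mono) (auto intro: ennreal_leI simp flip: ennreal_mult' split: split_indicator)
  also have "\<dots> = ennreal K"
    using halfline_densityD(4)[OF b] by (subst nn_integral_cmult) auto
  finally show ?thesis .
qed

lemma conv_on_ge_const:
  assumes b: "halfline_density b" and S [measurable]: "S \<in> sets borel" and K: "K \<ge> 0"
    and le: "\<And>u. u \<in> S \<Longrightarrow> 0 \<le> u \<Longrightarrow> K \<le> a (x - u)"
  shows "ennreal K * (\<integral>\<^sup>+ u. ennreal (b u) * indicator S u \<partial>lborel) \<le> conv_on S a b x"
proof -
  note [measurable] = halfline_densityD(1)[OF b]
  have *: "K * b u \<le> a (x - u) * b u" if "u \<in> S" for u
    using le[of u] that halfline_densityD(2,3)[OF b, of u] mult_right_mono[of K "a (x-u)" "b u"]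
    by (cases "u < 0") auto
  have "ennreal K * (\<integral>\<^sup>+ u. ennreal (b u) * indicator S u \<partial>lborel) =
      (\<integral>\<^sup>+ u. ennreal K * (ennreal (b u) * indicator S u) \<partial>lborel)"
    by (subst nn_integral_cmult) auto
  also have "\<dots> \<le> conv_on S a b x"
    unfolding conv_on_def using K *
    by (intro nn_integral_mono) (auto intro: ennreal_leI simp flip: ennreal_mult' split: split_indicator)
  finally show ?thesis .
qed

lemma conv_on_reflect:
  assumes [measurable]: "a \<in> borel_measurable borel" "b \<in> borel_measurable borel"
  shows "conv_on {x - A<..} a b x = conv_on {..<A} b a x"
proof -
  have "conv_on {x - A<..} a b x =
      (\<integral>\<^sup>+ u. ennreal (a (x - (x + -1 * u)) * b (x + -1 * u)) * indicator {x - A<..} (x + -1 * u) \<partial>lborel)"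
    unfolding conv_on_def by (subst nn_integral_real_affine[where c = "-1" and t = x]) auto
  also have "\<dots> = conv_on {..<A} b a x"
    unfolding conv_on_def by (intro nn_integral_cong) (auto simp: mult.commute split: split_indicator)
  finally show ?thesis .
qed

text \<open>By the reflection \<open>u \<mapsto> x - u\<close>, the upper end of the integral is the lower end with the
  factors exchanged, so the two end parts are treated by the same lemmas.\<close>

lemma conv_on_split:
  assumes [measurable]: "a \<in> borel_measurable borel" "b \<in> borel_measurable borel" and x: "2 * A \<le> x"
  shows "conv_on UNIV a b x = conv_on {..<A} a b x + conv_on {A..x - A} a b x + conv_on {..<A} b a x"
proof -
  have "conv_on UNIV a b x = (\<integral>\<^sup>+ u. (ennreal (a (x - u) * b u) * indicator {..<A} u
      + ennreal (a (x - u) * b u) * indicator {A..x - A} u)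
      + ennreal (a (x - u) * b u) * indicator {x - A<..} u \<partial>lborel)"
    unfolding conv_on_def using x by (intro nn_integral_cong) (auto split: split_indicator)
  also have "\<dots> = conv_on {..<A} a b x + conv_on {A..x - A} a b x + conv_on {x - A<..} a b x"
    unfolding conv_on_def by (simp add: nn_integral_add)
  finally show ?thesis by (simp add: conv_on_reflect)
qed

lemma conv_on_subset: "S \<subseteq> T \<Longrightarrow> conv_on S a b x \<le> conv_on T a b x"
  unfolding conv_on_def by (intro nn_integral_mono) (auto split: split_indicator)

lemma halfline_density_mass_tendsto:
  assumes b: "halfline_density b" and r: "r < 1"
  shows "\<forall>\<^sub>F A in at_top. ennreal r \<le> (\<integral>\<^sup>+ u. ennreal (b u) * indicator {..<A} u \<partial>lborel)"
proof -
  note [measurable] = halfline_densityD(1)[OF b]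
  have int: "integrable lborel b"
    using halfline_densityD(2,4)[OF b] by (intro integrableI_nonneg) auto
  have one: "(LINT u|lborel. b u) = 1"
    using halfline_densityD(2,4)[OF b] by (subst integral_eq_nn_integral) auto
  have "((\<lambda>A. LINT u|lborel. b u * indicator {..<A} u) \<longlongrightarrow> (LINT u|lborel. b u)) at_top"
  proof (rule integral_dominated_convergence_at_top[where w = b])
    show "AE u in lborel. ((\<lambda>A. b u * indicator {..<A} u) \<longlongrightarrow> b u) at_top"
    proof (rule AE_I2)
      fix u
      have "\<forall>\<^sub>F A in at_top. b u = b u * indicator {..<A} u"
        using eventually_gt_at_top[of u] by eventually_elim auto
      then show "((\<lambda>A. b u * indicator {..<A} u) \<longlongrightarrow> b u) at_top"
        by (rule Lim_transform_eventually[OF tendsto_const])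
    qed
    show "\<forall>\<^sub>F A in at_top. AE u in lborel. norm (b u * indicator {..<A} u) \<le> b u"
      using halfline_densityD(2)[OF b] by (auto split: split_indicator)
  qed (use int in auto)
  then have "\<forall>\<^sub>F A in at_top. r < (LINT u|lborel. b u * indicator {..<A} u)"
    using r one by (intro order_tendstoD) auto
  then show ?thesis
  proof eventually_elim
    case (elim A)
    have int_A: "integrable lborel (\<lambda>u. b u * indicator {..<A} u)"
      using int by (rule integrable_real_mult_indicator[rotated]) auto
    have "ennreal r \<le> ennreal (LINT u|lborel. b u * indicator {..<A} u)"
      using elim by (intro ennreal_leI) auto
    also have "\<dots> = (\<integral>\<^sup>+ u. ennreal (b u * indicator {..<A} u) \<partial>lborel)"
      using halfline_densityD(2)[OF b] int_A by (subst nn_integral_eq_integral) auto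
    also have "\<dots> = (\<integral>\<^sup>+ u. ennreal (b u) * indicator {..<A} u \<partial>lborel)"
      by (intro nn_integral_cong) (auto split: split_indicator)
    finally show ?case .
  qed
qed

text \<open>The comparisons \<open>liminf a / q \<ge> \<alpha>\<close> and \<open>a \<le> \<alpha> g + o(q)\<close>, stated without quotients. In the
  second one the error is measured by \<open>q\<close>, which may differ from \<open>g\<close>; this makes it possible to
  work with the error scale \<open>g\<close> and with the error scale \<open>p\<close> in the same way.\<close>

definition asymp_ge :: "(real \<Rightarrow> real) \<Rightarrow> real \<Rightarrow> (real \<Rightarrow> real) \<Rightarrow> bool" where
  "asymp_ge a \<alpha> q \<longleftrightarrow> (\<forall>\<beta><\<alpha>. \<forall>\<^sub>F x in at_top. \<beta> * q x \<le> a x)"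

definition asymp_le :: "(real \<Rightarrow> real) \<Rightarrow> real \<Rightarrow> (real \<Rightarrow> real) \<Rightarrow> (real \<Rightarrow> real) \<Rightarrow> bool" where
  "asymp_le a \<alpha> g q \<longleftrightarrow> (\<forall>\<eta>>0. \<forall>\<^sub>F x in at_top. a x \<le> \<alpha> * g x + \<eta> * q x)"

text \<open>In a self-convolution at \<open>x\<close>, the contribution of the middle, where both arguments are at
  least \<open>A\<close>, is negligible against \<open>q x\<close> once \<open>A\<close> is large. For long-tailed densities on the
  half line this is the same as subexponentiality, and in this form the property passes easily
  to other functions of the same order.\<close>

definition mid_small :: "(real \<Rightarrow> real) \<Rightarrow> bool" where
  "mid_small q \<longleftrightarrow>
     (\<forall>\<eta>>0. \<exists>A0. \<forall>A\<ge>A0. \<forall>\<^sub>F x in at_top. conv_on {A..x - A} q q x \<le> ennreal (\<eta> * q x))"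

lemma asymp_ge_refl: "(\<And>x. q x \<ge> 0) \<Longrightarrow> asymp_ge q 1 q"
  unfolding asymp_ge_def using mult_right_mono[of _ 1 "q _"]
  by (auto intro!: always_eventually)

text \<open>On the set where \<open>u\<close> is bounded, \<open>a (x - u)\<close> is at least about \<open>\<alpha> * q x\<close> by
  long-tailedness, and \<open>b\<close> has almost all of its mass there.\<close>

lemma end_part_lower:
  assumes b: "halfline_density b" and q: "long_tailed q"
    and a: "asymp_ge a \<alpha> q" and \<beta>: "\<beta> < \<alpha>"
  shows "\<exists>A0. \<forall>A\<ge>A0. \<forall>\<^sub>F x in at_top. ennreal (\<beta> * q x) \<le> conv_on {..<A} a b x"
proof (cases "\<beta> \<le> 0")
  case True
  then have "ennreal (\<beta> * q x) = 0" for x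
    using long_tailedD(2)[OF q, of x] by (simp add: ennreal_neg mult_nonpos_nonneg)
  then show ?thesis by auto
next
  case False
  define \<beta>' where "\<beta>' = (\<alpha> + \<beta>) / 2"
  \<comment> \<open>The factor \<open>\<beta> / \<beta>'\<close> is shared equally by the mass of \<open>b\<close> and the variation of \<open>q\<close>.\<close>
  define r where "r = sqrt (\<beta> / \<beta>')"
  have \<beta>': "\<beta> < \<beta>'" "\<beta>' < \<alpha>" using \<beta> by (auto simp: \<beta>'_def)
  have r: "0 < r" "r < 1" "r * r * \<beta>' = \<beta>"
    using \<beta>' False by (auto simp: r_def)
  obtain A0 where A0: "\<And>A. A \<ge> A0 \<Longrightarrow> ennreal r \<le> (\<integral>\<^sup>+ u. ennreal (b u) * indicator {..<A} u \<partial>lborel)"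
    using halfline_density_mass_tendsto[OF b r(2)] unfolding eventually_at_top_linorder by blast
  obtain Y where Y: "\<And>y. y \<ge> Y \<Longrightarrow> \<beta>' * q y \<le> a y"
    using a \<beta>' unfolding asymp_ge_def eventually_at_top_linorder by blast
  show ?thesis
  proof (rule exI[of _ "max 1 A0"], intro allI impI)
    fix A assume A: "max 1 A0 \<le> A"
    have "\<forall>\<^sub>F x in at_top. \<forall>u\<in>{0..A}. r * q x \<le> q (x - u) \<and> r * q (x - u) \<le> q x"
      using A by (intro long_tailed_uniform[OF q _ r(2)]) auto
    then show "\<forall>\<^sub>F x in at_top. ennreal (\<beta> * q x) \<le> conv_on {..<A} a b x"
      using eventually_ge_at_top[of "Y + A"]
    proof eventually_elim
      case (elim x)
      have qx: "q x \<ge> 0" using long_tailedD(2)[OF q] .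
      have *: "\<beta>' * (r * q x) \<le> a (x - u)" if u: "u < A" "0 \<le> u" for u
      proof -
        have "\<beta>' * (r * q x) \<le> \<beta>' * q (x - u)"
          using elim(1) u \<beta>' False by (intro mult_left_mono) auto
        also have "\<dots> \<le> a (x - u)" using elim(2) u by (intro Y) auto
        finally show ?thesis .
      qed
      have "ennreal (\<beta> * q x) = ennreal (\<beta>' * (r * q x) * r)"
        unfolding r(3)[symmetric] by (simp add: mult_ac)
      also have "\<dots> = ennreal (\<beta>' * (r * q x)) * ennreal r"
        using r by (simp add: ennreal_mult'')
      also have "\<dots> \<le> ennreal (\<beta>' * (r * q x)) * (\<integral>\<^sup>+ u. ennreal (b u) * indicator {..<A} u \<partial>lborel)"
        using A by (intro mult_left_mono A0) auto
      also have "\<dots> \<le> conv_on {..<A} a b x"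
        using qx \<beta>' False r by (intro conv_on_ge_const b *) auto
      finally show ?case .
    qed
  qed
qed

lemma ennreal_add_le: "ennreal (x + y) \<le> ennreal x + ennreal y"
proof -
  have "ennreal (x + y) \<le> ennreal (max 0 x + max 0 y)" by (intro ennreal_leI) auto
  also have "\<dots> = ennreal x + ennreal y"
    by (subst ennreal_plus) (auto simp: max_def ennreal_neg)
  finally show ?thesis .
qed

text \<open>The two ends of the range of integration are disjoint and contribute \<open>\<alpha>\<close> and \<open>\<beta>\<close>; the
  middle is nonnegative.\<close>

lemma conv_lower:
  assumes a: "halfline_density a" "asymp_ge a \<alpha> q" and b: "halfline_density b" "asymp_ge b \<beta> q"
    and q: "long_tailed q" and \<gamma>: "\<gamma> < \<alpha> + \<beta>"
  shows "\<forall>\<^sub>F x in at_top. ennreal (\<gamma> * q x) \<le> conv_on UNIV a b x"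
proof -
  define d where "d = (\<alpha> + \<beta> - \<gamma>) / 2"
  have d: "d > 0" "\<gamma> = (\<alpha> - d) + (\<beta> - d)" using \<gamma> by (auto simp: d_def field_simps)
  obtain A1 where A1: "\<And>A. A \<ge> A1 \<Longrightarrow> \<forall>\<^sub>F x in at_top. ennreal ((\<alpha> - d) * q x) \<le> conv_on {..<A} a b x"
    using end_part_lower[OF b(1) q a(2), of "\<alpha> - d"] d by auto
  obtain A2 where A2: "\<And>A. A \<ge> A2 \<Longrightarrow> \<forall>\<^sub>F x in at_top. ennreal ((\<beta> - d) * q x) \<le> conv_on {..<A} b a x"
    using end_part_lower[OF a(1) q b(2), of "\<beta> - d"] d by auto
  define A where "A = max A1 A2"
  have "\<forall>\<^sub>F x in at_top. ennreal ((\<alpha> - d) * q x) \<le> conv_on {..<A} a b x"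
    "\<forall>\<^sub>F x in at_top. ennreal ((\<beta> - d) * q x) \<le> conv_on {..<A} b a x"
    by (auto intro!: A1 A2 simp: A_def)
  then show ?thesis
    using eventually_ge_at_top[of "2 * A"]
  proof eventually_elim
    case (elim x)
    have "ennreal (\<gamma> * q x) = ennreal ((\<alpha> - d) * q x + (\<beta> - d) * q x)"
      unfolding d(2) by (simp add: algebra_simps)
    also have "\<dots> \<le> ennreal ((\<alpha> - d) * q x) + ennreal ((\<beta> - d) * q x)"
      by (rule ennreal_add_le)
    also have "\<dots> \<le> conv_on {..<A} a b x + conv_on {A..x - A} a b x + conv_on {..<A} b a x"
      using elim by (intro add_mono order_trans[OF elim(1)]) auto
    also have "\<dots> = conv_on UNIV a b x"
      using elim halfline_densityD(1)[OF a(1)] halfline_densityD(1)[OF b(1)] by (subst conv_on_split) auto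
    finally show ?case .
  qed
qed

text \<open>The two ends already account for the whole of \<open>2 * q x\<close>, so nothing is left for the
  middle. The factors \<open>a\<close> and \<open>b\<close> may differ from \<open>q\<close>: only lower bounds by \<open>q\<close> enter. This is
  what makes it possible below to draw a conclusion on \<open>q\<close> from a convolution in which it has
  been smoothed.\<close>

lemma mid_small_if_conv_le:
  assumes a: "halfline_density a" "asymp_ge a 1 q" and b: "halfline_density b" "asymp_ge b 1 q"
    and q: "long_tailed q"
    and le: "\<And>\<eta>. \<eta> > 0 \<Longrightarrow> \<forall>\<^sub>F x in at_top. conv_on UNIV a b x \<le> ennreal ((2 + \<eta>) * q x)"
  shows "mid_small q"
  unfolding mid_small_def
proof (intro allI impI)
  fix \<eta> :: real assume \<eta>: "\<eta> > 0"
  note [measurable] = halfline_densityD(1)[OF a(1)] halfline_densityD(1)[OF b(1)] long_tailedD(1)[OF q]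
  define d where "d = \<eta> / 12"
  have d: "d > 0" using \<eta> by (simp add: d_def)
  obtain A1 where A1: "\<And>A. A \<ge> A1 \<Longrightarrow> \<forall>\<^sub>F x in at_top. ennreal ((1 - d) * q x) \<le> conv_on {..<A} a b x"
    using end_part_lower[OF b(1) q a(2), of "1 - d"] d by auto
  obtain A2 where A2: "\<And>A. A \<ge> A2 \<Longrightarrow> \<forall>\<^sub>F x in at_top. ennreal ((1 - d) * q x) \<le> conv_on {..<A} b a x"
    using end_part_lower[OF a(1) q b(2), of "1 - d"] d by auto
  have "\<forall>\<^sub>F y in at_top. 1/2 * q y \<le> a y"
    using a(2) unfolding asymp_ge_def by (elim allE[of _ "1/2"]) auto
  then obtain Y1 where Y1: "\<And>y. y \<ge> Y1 \<Longrightarrow> 1/2 * q y \<le> a y"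
    unfolding eventually_at_top_linorder by blast
  have "\<forall>\<^sub>F y in at_top. 1/2 * q y \<le> b y"
    using b(2) unfolding asymp_ge_def by (elim allE[of _ "1/2"]) auto
  then obtain Y2 where Y2: "\<And>y. y \<ge> Y2 \<Longrightarrow> 1/2 * q y \<le> b y"
    unfolding eventually_at_top_linorder by blast
  show "\<exists>A0. \<forall>A\<ge>A0. \<forall>\<^sub>F x in at_top. conv_on {A..x - A} q q x \<le> ennreal (\<eta> * q x)"
  proof (rule exI[of _ "max (max A1 A2) (max Y1 Y2)"], intro allI impI)
    fix A assume A: "max (max A1 A2) (max Y1 Y2) \<le> A"
    have "\<forall>\<^sub>F x in at_top. ennreal ((1 - d) * q x) \<le> conv_on {..<A} a b x"
      "\<forall>\<^sub>F x in at_top. ennreal ((1 - d) * q x) \<le> conv_on {..<A} b a x"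
      using A by (auto intro!: A1 A2)
    then show "\<forall>\<^sub>F x in at_top. conv_on {A..x - A} q q x \<le> ennreal (\<eta> * q x)"
      using le[OF d] eventually_ge_at_top[of "2 * A"]
    proof eventually_elim
      case (elim x)
      have qx: "q x \<ge> 0" using long_tailedD(2)[OF q] .
      let ?m = "conv_on {A..x - A} a b x"
      have "ennreal ((1 - d) * q x) + ?m + ennreal ((1 - d) * q x) \<le> conv_on UNIV a b x"
        using elim by (subst conv_on_split[of _ _ A]) (auto intro!: add_mono)
      also note elim(3)
      finally have *: "ennreal ((1 - d) * q x) + ?m + ennreal ((1 - d) * q x) \<le> ennreal ((2 + d) * q x)" .
      have "?m \<le> ennreal ((1 - d) * q x) + ?m + ennreal ((1 - d) * q x)"
        by (metis add.commute add.left_commute le_iff_add)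
      also note *
      finally have "?m < \<infinity>" by (simp add: ennreal_less_top order_le_less_trans)
      then obtain m where m: "?m = ennreal m" "m \<ge> 0" by (cases ?m) auto
      have "ennreal ((1 - d) * q x + m + (1 - d) * q x) \<le> ennreal ((1 - d) * q x) + ?m + ennreal ((1 - d) * q x)"
        unfolding m(1) by (meson add_right_mono ennreal_add_le order_trans)
      also note *
      finally have "(1 - d) * q x + m + (1 - d) * q x \<le> (2 + d) * q x"
        using qx d by (subst (asm) ennreal_le_iff) auto
      then have m_le: "m \<le> 3 * d * q x" by (simp add: algebra_simps)
      have "conv_on {A..x - A} q q x \<le> ennreal 4 * ?m"
      proof (rule conv_on_le_cmult)
        fix u assume u: "u \<in> {A..x - A}"
        have "1/2 * q (x - u) * (1/2 * q u) \<le> a (x - u) * b u"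
          using u A long_tailedD(2)[OF q] halfline_densityD(2)[OF a(1)]
          by (intro mult_mono Y1 Y2) auto
        then show "q (x - u) * q u \<le> 4 * (a (x - u) * b u)" by simp
      qed auto
      also have "\<dots> = ennreal (4 * m)" by (simp add: m ennreal_mult')
      also have "\<dots> \<le> ennreal (\<eta> * q x)"
        using m_le by (intro ennreal_leI) (simp add: d_def)
      finally show ?case .
    qed
  qed
qed

text \<open>Over a bounded range of \<open>u\<close>, both \<open>g (x - u)\<close> and \<open>q (x - u)\<close> exceed \<open>g x\<close> and \<open>q x\<close> by at
  most a factor \<open>1 + \<theta>\<close>, and \<open>\<theta> * g x\<close> is absorbed into the error since \<open>g\<close> is of the order of
  \<open>q\<close>.\<close>

lemma end_part_upper:
  assumes b: "halfline_density b" and q: "long_tailed q" and g: "long_tailed g"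
    and gq: "\<forall>\<^sub>F x in at_top. g x \<le> K * q x" and K: "K \<ge> 0"
    and a: "asymp_le a \<alpha> g q" and \<alpha>: "\<alpha> \<ge> 0" and \<eta>: "\<eta> > 0"
  shows "\<forall>\<^sub>F x in at_top. conv_on {..<A} a b x \<le> ennreal (\<alpha> * g x + \<eta> * q x)"
proof -
  define \<theta> where "\<theta> = min 1 (\<eta> / (2 * (\<alpha> * K + 1)))"
  have aK: "\<alpha> * K \<ge> 0" using \<alpha> K by simp
  have \<theta>: "0 < \<theta>" "\<theta> \<le> 1" using \<eta> aK by (auto simp: \<theta>_def intro!: divide_pos_pos)
  have "\<theta> * (\<alpha> * K) \<le> \<eta> / (2 * (\<alpha> * K + 1)) * (\<alpha> * K + 1)"
    using aK \<theta> by (intro mult_mono) (auto simp: \<theta>_def)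
  also have "\<dots> = \<eta> / 2" using aK by (simp add: field_simps)
  finally have \<theta>_le: "\<theta> * (\<alpha> * K) \<le> \<eta> / 2" .
  define r where "r = 1 / (1 + \<theta>)"
  have r: "r < 1" "0 < r" "1 / r = 1 + \<theta>" using \<theta> by (auto simp: r_def)
  obtain Y where Y: "\<And>y. y \<ge> Y \<Longrightarrow> a y \<le> \<alpha> * g y + \<eta> / 4 * q y"
    using a \<eta> unfolding asymp_le_def eventually_at_top_linorder
    by (metis divide_pos_pos zero_less_numeral)
  define T where "T = max 1 A"
  have "\<forall>\<^sub>F x in at_top. \<forall>u\<in>{0..T}. r * q x \<le> q (x - u) \<and> r * q (x - u) \<le> q x"
    "\<forall>\<^sub>F x in at_top. \<forall>u\<in>{0..T}. r * g x \<le> g (x - u) \<and> r * g (x - u) \<le> g x"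
    using r by (auto intro!: long_tailed_uniform q g simp: T_def)
  then show ?thesis using gq eventually_ge_at_top[of "Y + T"]
  proof eventually_elim
    case (elim x)
    have nn: "q x \<ge> 0" "g x \<ge> 0" using long_tailedD(2) q g by auto
    have "a (x - u) \<le> \<alpha> * g x + \<eta> * q x" if u: "u \<in> {..<A}" "0 \<le> u" for u
    proof -
      have uT: "u \<in> {0..T}" using u by (auto simp: T_def)
      have "g (x - u) \<le> (1 + \<theta>) * g x" "q (x - u) \<le> (1 + \<theta>) * q x"
        using elim(1,2) uT r(2) unfolding r(3)[symmetric] by (auto simp: field_simps)
      then have "\<alpha> * g (x - u) + \<eta> / 4 * q (x - u) \<le> \<alpha> * ((1 + \<theta>) * g x) + \<eta> / 4 * ((1 + \<theta>) * q x)"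
        using \<alpha> \<eta> by (intro add_mono mult_left_mono) auto
      also have "\<dots> = \<alpha> * g x + \<theta> * \<alpha> * g x + \<eta> / 4 * (1 + \<theta>) * q x" by (simp add: algebra_simps)
      also have "\<dots> \<le> \<alpha> * g x + \<theta> * \<alpha> * (K * q x) + \<eta> / 4 * 2 * q x"
        using \<alpha> \<eta> \<theta> elim(3) nn by (intro add_mono mult_left_mono mult_right_mono) auto
      also have "\<dots> = \<alpha> * g x + (\<theta> * (\<alpha> * K) + \<eta> / 2) * q x" by (simp add: algebra_simps)
      also have "\<dots> \<le> \<alpha> * g x + \<eta> * q x"
        using \<theta>_le nn by (intro add_mono mult_right_mono) auto
      finally show ?thesis using Y[of "x - u"] elim(4) uT by auto
    qed
    then show ?case using nn \<alpha> \<eta> by (intro conv_on_le_const b) auto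
  qed
qed

lemma asymp_le_imp_bigo:
  assumes gq: "\<forall>\<^sub>F x in at_top. g x \<le> K * q x" and a: "asymp_le a \<alpha> g q" and \<alpha>: "\<alpha> \<ge> 0"
  shows "\<forall>\<^sub>F x in at_top. a x \<le> (\<alpha> * K + 1) * q x"
proof -
  have "\<forall>\<^sub>F x in at_top. a x \<le> \<alpha> * g x + 1 * q x"
    using a unfolding asymp_le_def by (elim allE[of _ 1]) auto
  then show ?thesis using gq
  proof eventually_elim
    case (elim x)
    then have "\<alpha> * g x \<le> \<alpha> * (K * q x)" using \<alpha> by (intro mult_left_mono)
    with elim show ?case by (simp add: algebra_simps)
  qed
qed

text \<open>Both factors are of the order of \<open>q\<close>, so the middle part is negligible on the scale \<open>q\<close>,
  and each end contributes the leading term of one factor.\<close>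

lemma conv_upper:
  assumes a: "halfline_density a" "asymp_le a \<alpha> g q" "\<alpha> \<ge> 0"
    and b: "halfline_density b" "asymp_le b \<beta> g q" "\<beta> \<ge> 0"
    and q: "long_tailed q" "mid_small q" and g: "long_tailed g"
    and gq: "\<forall>\<^sub>F x in at_top. g x \<le> K * q x" and K: "K \<ge> 0" and \<eta>: "\<eta> > 0"
  shows "\<forall>\<^sub>F x in at_top. conv_on UNIV a b x \<le> ennreal ((\<alpha> + \<beta>) * g x + \<eta> * q x)"
proof -
  note [measurable] = halfline_densityD(1)[OF a(1)] halfline_densityD(1)[OF b(1)] long_tailedD(1)[OF q(1)]
  define L where "L = (\<alpha> * K + 1) * (\<beta> * K + 1)"
  have L: "L > 0" using a b K by (auto simp: L_def intro!: mult_pos_pos add_nonneg_pos)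
  obtain Y1 where Y1: "\<And>y. y \<ge> Y1 \<Longrightarrow> a y \<le> (\<alpha> * K + 1) * q y"
    using asymp_le_imp_bigo[OF gq a(2,3)] unfolding eventually_at_top_linorder by blast
  obtain Y2 where Y2: "\<And>y. y \<ge> Y2 \<Longrightarrow> b y \<le> (\<beta> * K + 1) * q y"
    using asymp_le_imp_bigo[OF gq b(2,3)] unfolding eventually_at_top_linorder by blast
  obtain A0 where A0: "\<And>A. A \<ge> A0 \<Longrightarrow>
      \<forall>\<^sub>F x in at_top. conv_on {A..x - A} q q x \<le> ennreal (\<eta> / (3 * L) * q x)"
    using q(2) \<eta> L unfolding mid_small_def by (meson divide_pos_pos mult_pos_pos zero_less_numeral)
  define A where "A = max A0 (max Y1 Y2)"
  have "\<forall>\<^sub>F x in at_top. conv_on {A..x - A} q q x \<le> ennreal (\<eta> / (3 * L) * q x)"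
    by (rule A0) (simp add: A_def)
  moreover have "\<forall>\<^sub>F x in at_top. conv_on {..<A} a b x \<le> ennreal (\<alpha> * g x + \<eta> / 3 * q x)"
    using \<eta> by (intro end_part_upper[OF b(1) q(1) g gq K a(2,3)]) auto
  moreover have "\<forall>\<^sub>F x in at_top. conv_on {..<A} b a x \<le> ennreal (\<beta> * g x + \<eta> / 3 * q x)"
    using \<eta> by (intro end_part_upper[OF a(1) q(1) g gq K b(2,3)]) auto
  ultimately show ?thesis using eventually_ge_at_top[of "2 * A"]
  proof eventually_elim
    case (elim x)
    have nn: "q x \<ge> 0" "g x \<ge> 0" using long_tailedD(2) q(1) g by auto
    have "conv_on {A..x - A} a b x \<le> ennreal L * conv_on {A..x - A} q q x"
    proof (rule conv_on_le_cmult)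
      fix u assume u: "u \<in> {A..x - A}"
      have "a (x - u) * b u \<le> ((\<alpha> * K + 1) * q (x - u)) * ((\<beta> * K + 1) * q u)"
        using u halfline_densityD(2)[OF b(1)] long_tailedD(2)[OF q(1)] a(3) K
        by (intro mult_mono Y1 Y2) (auto simp: A_def)
      then show "a (x - u) * b u \<le> L * (q (x - u) * q u)" by (simp add: L_def algebra_simps)
    qed (use L in auto)
    also have "\<dots> \<le> ennreal L * ennreal (\<eta> / (3 * L) * q x)"
      using elim by (intro mult_left_mono) auto
    also have "\<dots> = ennreal (\<eta> / 3 * q x)"
      using L by (simp add: ennreal_mult'[symmetric])
    finally have mid: "conv_on {A..x - A} a b x \<le> ennreal (\<eta> / 3 * q x)" .
    have "conv_on UNIV a b x \<le> ennreal (\<alpha> * g x + \<eta> / 3 * q x) + ennreal (\<eta> / 3 * q x)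
        + ennreal (\<beta> * g x + \<eta> / 3 * q x)"
      using elim mid by (subst conv_on_split[of _ _ A]) (auto intro!: add_mono)
    also have "\<dots> = ennreal ((\<alpha> + \<beta>) * g x + \<eta> * q x)"
      using nn a(3) b(3) \<eta> by (simp add: algebra_simps flip: ennreal_plus)
    finally show ?case .
  qed
qed

section \<open>Asymptotics of Poisson mixtures of convolution powers\<close>

lemma conv_on_commute:
  assumes [measurable]: "a \<in> borel_measurable borel" "b \<in> borel_measurable borel"
  shows "conv_on UNIV a b x = conv_on UNIV b a x"
proof -
  have "conv_on UNIV a b x =
      (\<integral>\<^sup>+ u. ennreal (a (x - (x + -1 * u)) * b (x + -1 * u)) * indicator UNIV (x + -1 * u) \<partial>lborel)"
    unfolding conv_on_def by (subst nn_integral_real_affine[where c = "-1" and t = x]) auto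
  also have "\<dots> = conv_on UNIV b a x"
    unfolding conv_on_def by (intro nn_integral_cong) (auto simp: mult.commute)
  finally show ?thesis .
qed

lemma conv_on_Un_le:
  assumes [measurable]: "a \<in> borel_measurable borel" "b \<in> borel_measurable borel"
    "S \<in> sets borel" "T \<in> sets borel"
  shows "conv_on (S \<union> T) a b x \<le> conv_on S a b x + conv_on T a b x"
proof -
  have "conv_on (S \<union> T) a b x \<le>
      (\<integral>\<^sup>+ u. ennreal (a (x - u) * b u) * indicator S u + ennreal (a (x - u) * b u) * indicator T u \<partial>lborel)"
    unfolding conv_on_def by (intro nn_integral_mono) (auto split: split_indicator)
  also have "\<dots> = conv_on S a b x + conv_on T a b x"
    unfolding conv_on_def by (intro nn_integral_add) auto
  finally show ?thesis .
qed

lemma halfline_density_prob_space: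
  assumes "halfline_density a"
  shows "prob_space (density lborel (\<lambda>x. ennreal (a x)))"
  using halfline_densityD[OF assms] by (intro prob_spaceI) (auto simp: emeasure_density)

lemma conv_on_halfline_bounded:
  assumes a: "halfline_density a" and b: "halfline_density b" and M: "\<And>x. b x \<le> M"
  shows "conv_on UNIV a b x \<le> ennreal M" "conv_on UNIV a b x = ennreal (density_conv a b x)"
proof -
  have "0 \<le> M" using M[of 0] halfline_densityD(2)[OF b, of 0] by linarith
  then have "conv_on UNIV b a x \<le> ennreal M" by (intro conv_on_le_const a M)
  then show 1: "conv_on UNIV a b x \<le> ennreal M"
    by (subst conv_on_commute) (auto intro: halfline_densityD a b)
  then show "conv_on UNIV a b x = ennreal (density_conv a b x)"
    unfolding density_conv_eq_conv_on[OF a b] by (auto simp: order_le_less_trans)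
qed

lemma density_conv_eq_convolution:
  assumes a: "halfline_density a" and b: "halfline_density b" and M: "\<And>x. b x \<le> M"
  shows "density lborel (\<lambda>x. ennreal (density_conv a b x)) =
    convolution (density lborel (\<lambda>x. ennreal (a x))) (density lborel (\<lambda>x. ennreal (b x)))"
proof -
  note [measurable] = halfline_densityD(1)[OF a] halfline_densityD(1)[OF b]
  interpret A: prob_space "density lborel (\<lambda>x. ennreal (a x))" by (rule halfline_density_prob_space[OF a])
  interpret B: prob_space "density lborel (\<lambda>x. ennreal (b x))" by (rule halfline_density_prob_space[OF b])
  have "convolution (density lborel (\<lambda>x. ennreal (a x))) (density lborel (\<lambda>x. ennreal (b x))) =
      density lborel (\<lambda>x. \<integral>\<^sup>+ y. ennreal (a (x - y)) * ennreal (b y) \<partial>lborel)"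
    by (intro convolution_density A.finite_measure_axioms B.finite_measure_axioms) auto
  also have "(\<lambda>x. \<integral>\<^sup>+ y. ennreal (a (x - y)) * ennreal (b y) \<partial>lborel) = (\<lambda>x. ennreal (density_conv a b x))"
    unfolding conv_on_halfline_bounded(2)[OF a b M, symmetric] conv_on_def
    using halfline_densityD(2)[OF a] by (simp add: ennreal_mult')
  finally show ?thesis ..
qed

lemma halfline_density_conv:
  assumes a: "halfline_density a" and b: "halfline_density b" and M: "\<And>x. b x \<le> M"
  shows "halfline_density (density_conv a b)"
  unfolding halfline_density_def
proof (intro conjI allI impI)
  note [measurable] = halfline_densityD(1)[OF a] halfline_densityD(1)[OF b]
  show meas [measurable]: "density_conv a b \<in> borel_measurable borel"
    unfolding density_conv_def[abs_def] by measurable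
  show "density_conv a b x \<ge> 0" for x
    unfolding density_conv_eq_conv_on[OF a b] by simp
  show "density_conv a b x = 0" if "x < 0" for x
  proof -
    have "a (x - u) * b u = 0" for u
      using that halfline_densityD(3)[OF a, of "x - u"] halfline_densityD(3)[OF b, of u]
      by (cases "u < 0") auto
    then show ?thesis unfolding density_conv_def by (simp only: integral_zero)
  qed
  have "prob_space (density lborel (\<lambda>x. ennreal (density_conv a b x)))"
    using density_conv_eq_convolution[OF a b M]
      prob_space_convolution_density[of "\<lambda>x. ennreal (a x)" "\<lambda>x. ennreal (b x)"]
      halfline_density_prob_space[OF a] halfline_density_prob_space[OF b]
    by (simp add: convolution_density prob_space_def)
  from prob_space.emeasure_space_1[OF this]
  show "(\<integral>\<^sup>+ x. ennreal (density_conv a b x) \<partial>lborel) = 1"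
    by (simp add: emeasure_density)
qed

text \<open>The iteration starts from \<open>f\<close> instead of a unit mass at 0, which has no density, and every
  term with a positive index is bounded by the bound of \<open>g\<close>.\<close>

primrec conv_iter :: "(real \<Rightarrow> real) \<Rightarrow> (real \<Rightarrow> real) \<Rightarrow> nat \<Rightarrow> real \<Rightarrow> real" where
  "conv_iter f g 0 = f"
| "conv_iter f g (Suc n) = density_conv (conv_iter f g n) g"

definition poisson_weight :: "real \<Rightarrow> nat \<Rightarrow> real" where
  "poisson_weight l n = exp (- l) * (l ^ n / fact n)"

text \<open>The density of the convolution of the law with density \<open>f\<close> and the compound Poisson law
  with intensity \<open>l\<close> and jump density \<open>g\<close>. The atom of the compound Poisson law at 0 gives the
  term with \<open>n = 0\<close>.\<close>

definition poisson_mixture :: "real \<Rightarrow> (real \<Rightarrow> real) \<Rightarrow> (real \<Rightarrow> real) \<Rightarrow> real \<Rightarrow> real" where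
  "poisson_mixture l f g x = (\<Sum>n. poisson_weight l n * conv_iter f g n x)"

lemma halfline_density_conv_iter:
  assumes "halfline_density f" "halfline_density g" "\<And>x. g x \<le> M"
  shows "halfline_density (conv_iter f g n)"
  by (induction n) (use assms in \<open>auto intro: halfline_density_conv\<close>)

lemma conv_on_conv_iter:
  assumes "halfline_density f" "halfline_density g" "\<And>x. g x \<le> M"
  shows "conv_on UNIV (conv_iter f g n) g x = ennreal (conv_iter f g (Suc n) x)"
  using conv_on_halfline_bounded(2)[OF halfline_density_conv_iter[OF assms] assms(2,3)] by simp

lemma conv_iter_le:
  assumes "halfline_density f" "halfline_density g" "\<And>x. g x \<le> M"
  shows "conv_iter f g n x \<le> max (f x) M"
proof (cases n)
  case (Suc m)
  have "0 \<le> M" using assms(3)[of 0] halfline_densityD(2)[OF assms(2), of 0] by linarith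
  moreover have "ennreal (conv_iter f g n x) \<le> ennreal M"
    using conv_on_halfline_bounded(1)[OF halfline_density_conv_iter[OF assms] assms(2,3)]
      conv_on_conv_iter[OF assms] Suc by metis
  ultimately show ?thesis by (simp add: ennreal_le_iff le_max_iff_disj)
qed simp

text \<open>The generating function of the Poisson distribution.\<close>

lemma poisson_weight_sums:
  "(\<lambda>n. poisson_weight l n * z ^ n) sums exp (l * (z - 1))"
proof -
  have "(\<lambda>n. exp (- l) * ((l * z) ^ n /\<^sub>R fact n)) sums (exp (- l) * exp (l * z))"
    by (intro sums_mult exp_converges)
  then show ?thesis
    by (simp add: poisson_weight_def field_simps power_mult_distrib exp_minus exp_diff)
qed

lemma poisson_weight_sums_1: "poisson_weight l sums 1"
  using poisson_weight_sums[of l 1] by simp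

lemma poisson_weight_nonneg: "l \<ge> 0 \<Longrightarrow> poisson_weight l n \<ge> 0"
  by (simp add: poisson_weight_def)

lemma poisson_weight_mean_sums: "(\<lambda>n. poisson_weight l n * real n) sums l"
proof -
  have "(\<lambda>n. l * poisson_weight l n) sums (l * 1)"
    by (intro sums_mult poisson_weight_sums_1)
  also have "(\<lambda>n. l * poisson_weight l n) = (\<lambda>n. poisson_weight l (Suc n) * real (Suc n))"
    by (auto simp: poisson_weight_def fun_eq_iff divide_simps simp del: of_nat_Suc)
  finally show ?thesis by (subst (asm) sums_Suc_iff) simp
qed

context
  fixes l M :: real and f g :: "real \<Rightarrow> real"
  assumes l: "l \<ge> 0" and f: "halfline_density f" and g: "halfline_density g"
    and M: "\<And>x. g x \<le> M"
begin

lemma conv_iter_nonneg: "conv_iter f g n x \<ge> 0"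
  by (rule halfline_densityD(2)[OF halfline_density_conv_iter[OF f g M]])

lemma poisson_mixture_summable: "summable (\<lambda>n. poisson_weight l n * conv_iter f g n x)"
proof (rule summable_comparison_test')
  show "summable (\<lambda>n. poisson_weight l n * max (f x) M)"
    using poisson_weight_sums_1 by (intro summable_mult2) (rule sums_summable)
  show "norm (poisson_weight l n * conv_iter f g n x) \<le> poisson_weight l n * max (f x) M" for n
    using conv_iter_nonneg poisson_weight_nonneg[OF l] conv_iter_le[OF f g M]
    by (auto simp: abs_mult intro: mult_left_mono)
qed

lemma ennreal_poisson_mixture:
  "ennreal (poisson_mixture l f g x) = (\<Sum>n. ennreal (poisson_weight l n) * ennreal (conv_iter f g n x))"
  unfolding poisson_mixture_def using conv_iter_nonneg poisson_weight_nonneg[OF l]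
  by (subst suminf_ennreal2[symmetric]) (auto intro: poisson_mixture_summable simp: ennreal_mult')

lemma conv_iter_measurable [measurable]: "conv_iter f g n \<in> borel_measurable borel"
  by (rule halfline_densityD(1)[OF halfline_density_conv_iter[OF f g M]])

lemma halfline_density_poisson_mixture: "halfline_density (poisson_mixture l f g)"
  unfolding halfline_density_def
proof (intro conjI allI impI)
  show "poisson_mixture l f g \<in> borel_measurable borel"
    unfolding poisson_mixture_def[abs_def] by measurable
  show "poisson_mixture l f g x \<ge> 0" for x
    unfolding poisson_mixture_def
    by (intro suminf_nonneg poisson_mixture_summable mult_nonneg_nonneg conv_iter_nonneg poisson_weight_nonneg l)
  show "poisson_mixture l f g x = 0" if "x < 0" for x
    using halfline_densityD(3)[OF halfline_density_conv_iter[OF f g M] that]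
    by (simp add: poisson_mixture_def)
  have "(\<integral>\<^sup>+ x. ennreal (poisson_mixture l f g x) \<partial>lborel) =
      (\<Sum>n. \<integral>\<^sup>+ x. ennreal (poisson_weight l n) * ennreal (conv_iter f g n x) \<partial>lborel)"
    unfolding ennreal_poisson_mixture by (intro nn_integral_suminf) auto
  also have "\<dots> = (\<Sum>n. ennreal (poisson_weight l n))"
    using halfline_densityD(4)[OF halfline_density_conv_iter[OF f g M]]
    by (intro suminf_cong) (simp add: nn_integral_cmult)
  also have "\<dots> = 1"
    using poisson_weight_sums_1[of l] poisson_weight_nonneg[OF l]
    by (subst suminf_ennreal2) (auto dest: sums_summable sums_unique[symmetric])
  finally show "(\<integral>\<^sup>+ x. ennreal (poisson_mixture l f g x) \<partial>lborel) = 1" .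
qed

lemma conv_iter_asymp_ge:
  assumes gL: "long_tailed g"
  shows "asymp_ge (conv_iter f g n) (real n) g"
proof (induction n)
  case 0
  show ?case
    unfolding asymp_ge_def
  proof (intro allI impI always_eventually)
    fix \<beta> x assume "\<beta> < real 0"
    then have "\<beta> * g x \<le> 0" using halfline_densityD(2)[OF g] by (simp add: mult_nonpos_nonneg)
    then show "\<beta> * g x \<le> conv_iter f g 0 x" using conv_iter_nonneg[of 0 x] by linarith
  qed
next
  case (Suc n)
  show ?case
    unfolding asymp_ge_def
  proof (intro allI impI)
    fix \<beta> assume \<beta>: "\<beta> < real (Suc n)"
    have "\<forall>\<^sub>F x in at_top. ennreal (\<beta> * g x) \<le> conv_on UNIV (conv_iter f g n) g x"
      using \<beta> by (intro conv_lower[OF halfline_density_conv_iter[OF f g M] Suc.IH g asymp_ge_refl gL]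
        halfline_densityD(2)[OF g]) auto
    then show "\<forall>\<^sub>F x in at_top. \<beta> * g x \<le> conv_iter f g (Suc n) x"
      unfolding conv_on_conv_iter[OF f g M]
      by eventually_elim (use conv_iter_nonneg in \<open>simp add: ennreal_le_iff del: conv_iter.simps\<close>)
  qed
qed

text \<open>A form of Fatou's lemma: each \<open>n\<close>-fold term contributes at least \<open>n\<close> times its weight, and
  the mean of the Poisson distribution is \<open>l\<close>.\<close>

lemma poisson_mixture_asymp_ge:
  assumes gL: "long_tailed g"
  shows "asymp_ge (poisson_mixture l f g) l g"
  unfolding asymp_ge_def
proof (intro allI impI)
  fix \<beta> assume \<beta>: "\<beta> < l"
  define \<eta> where "\<eta> = (l - \<beta>) / 2"
  have \<eta>: "\<eta> > 0" using \<beta> by (simp add: \<eta>_def)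
  have "(\<lambda>N. \<Sum>n<N. poisson_weight l n * real n) \<longlonglongrightarrow> l"
    using poisson_weight_mean_sums[of l] by (simp add: sums_def)
  then have "\<forall>\<^sub>F N in sequentially. l - \<eta> < (\<Sum>n<N. poisson_weight l n * real n)"
    using \<eta> by (intro order_tendstoD) auto
  then obtain N where N: "l - \<eta> < (\<Sum>n<N. poisson_weight l n * real n)"
    by (auto simp: eventually_sequentially)
  have N1: "(\<Sum>n<N. poisson_weight l n) \<le> 1"
    using poisson_weight_sums_1[of l] poisson_weight_nonneg[OF l]
    by (metis finite_lessThan sum_le_suminf sums_summable sums_unique)
  have "\<forall>\<^sub>F x in at_top. \<forall>n\<in>{..<N}. (real n - \<eta>) * g x \<le> conv_iter f g n x"
  proof (intro eventually_ball_finite finite_lessThan ballI)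
    fix n
    show "\<forall>\<^sub>F x in at_top. (real n - \<eta>) * g x \<le> conv_iter f g n x"
      using conv_iter_asymp_ge[OF gL, of n] \<eta> unfolding asymp_ge_def by simp
  qed
  then show "\<forall>\<^sub>F x in at_top. \<beta> * g x \<le> poisson_mixture l f g x"
  proof eventually_elim
    case (elim x)
    have gx: "g x \<ge> 0" by (rule halfline_densityD(2)[OF g])
    have "\<beta> \<le> (\<Sum>n<N. poisson_weight l n * real n) - \<eta> * (\<Sum>n<N. poisson_weight l n)"
    proof -
      have "\<eta> * (\<Sum>n<N. poisson_weight l n) \<le> \<eta> * 1" using \<eta> N1 by (intro mult_left_mono) auto
      then show ?thesis using N by (simp add: \<eta>_def field_simps)
    qed
    also have "\<dots> = (\<Sum>n<N. poisson_weight l n * (real n - \<eta>))"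
      by (simp add: sum_subtractf sum_distrib_left algebra_simps)
    finally have "\<beta> * g x \<le> (\<Sum>n<N. poisson_weight l n * (real n - \<eta>)) * g x"
      using gx by (intro mult_right_mono)
    also have "\<dots> = (\<Sum>n<N. poisson_weight l n * ((real n - \<eta>) * g x))"
      by (simp add: sum_distrib_right mult.assoc)
    also have "\<dots> \<le> (\<Sum>n<N. poisson_weight l n * conv_iter f g n x)"
      using elim poisson_weight_nonneg[OF l] by (intro sum_mono mult_left_mono) auto
    also have "\<dots> \<le> poisson_mixture l f g x"
      unfolding poisson_mixture_def
      by (intro sum_le_suminf poisson_mixture_summable) (auto intro: mult_nonneg_nonneg conv_iter_nonneg poisson_weight_nonneg l)
    finally show ?case .
  qed
qed

context
  fixes q :: "real \<Rightarrow> real" and K :: real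
  assumes q: "halfline_density q" "long_tailed q" "mid_small q" and gL: "long_tailed g"
    and gq: "\<forall>\<^sub>F x in at_top. g x \<le> K * q x" and K: "K \<ge> 0"
    and fq: "asymp_le f 0 g q"
begin

lemma conv_iter_asymp_le: "asymp_le (conv_iter f g n) (real n) g q"
proof (induction n)
  case 0
  then show ?case using fq by simp
next
  case (Suc n)
  have g1: "asymp_le g 1 g q"
    unfolding asymp_le_def using halfline_densityD(2)[OF q(1)] by (auto intro!: always_eventually)
  show ?case
    unfolding asymp_le_def
  proof (intro allI impI)
    fix \<eta> :: real assume \<eta>: "\<eta> > 0"
    have "\<forall>\<^sub>F x in at_top. conv_on UNIV (conv_iter f g n) g x \<le> ennreal ((real n + 1) * g x + \<eta> * q x)"
      by (intro conv_upper[OF halfline_density_conv_iter[OF f g M] Suc.IH _ g g1 _ q(2,3) gL gq K \<eta>]) auto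
    then show "\<forall>\<^sub>F x in at_top. conv_iter f g (Suc n) x \<le> real (Suc n) * g x + \<eta> * q x"
      unfolding conv_on_conv_iter[OF f g M]
    proof eventually_elim
      case (elim x)
      have "(real n + 1) * g x + \<eta> * q x \<ge> 0"
        using \<eta> halfline_densityD(2)[OF q(1)] halfline_densityD(2)[OF g] by auto
      then show ?case using elim by (simp add: ennreal_le_iff algebra_simps del: conv_iter.simps)
    qed
  qed
qed

text \<open>Kesten's bound in a weak form. Any geometric growth will do, because the Poisson weights
  decay faster than geometrically; the base \<open>B\<close> can therefore be the crude constant of a
  one-step recursion. At \<open>x\<close>, the range of the argument \<open>x - u\<close> of the \<open>n\<close>-fold term is cut at
  \<open>A\<close>: above \<open>A\<close> the induction hypothesis applies, and below \<open>A\<close> the total mass 1 of that term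
  is used together with a bound on \<open>g\<close>.\<close>

lemma conv_iter_geometric_bound:
  "\<exists>A B. \<forall>n. \<forall>x\<ge>A. conv_iter f g n x \<le> B ^ n * q x"
proof -
  note [measurable] = halfline_densityD(1)[OF q(1)] halfline_densityD(1)[OF g]
  have qq: "asymp_le q 1 q q"
    unfolding asymp_le_def using halfline_densityD(2)[OF q(1)] by (auto intro!: always_eventually)
  have "\<forall>\<^sub>F x in at_top. conv_on UNIV q q x \<le> ennreal ((1 + 1) * q x + 1 * q x)"
    by (rule conv_upper[where K = 1]) (use q qq in auto)
  then obtain X1 where X1: "\<And>x. x \<ge> X1 \<Longrightarrow> conv_on UNIV q q x \<le> ennreal (3 * q x)"
    unfolding eventually_at_top_linorder by auto
  obtain X2 where X2: "\<And>x. x \<ge> X2 \<Longrightarrow> g x \<le> K * q x"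
    using gq unfolding eventually_at_top_linorder by auto
  have "\<forall>\<^sub>F x in at_top. f x \<le> 0 * g x + 1 * q x"
    using fq unfolding asymp_le_def by (elim allE[of _ 1]) auto
  then obtain X3 where X3: "\<And>x. x \<ge> X3 \<Longrightarrow> f x \<le> q x"
    unfolding eventually_at_top_linorder by auto
  obtain A0 where A0: "\<And>A. A \<ge> A0 \<Longrightarrow> q A > 0 \<and> (\<exists>c>0. \<forall>y\<ge>A. \<forall>u\<in>{0..A}. q y \<le> c * q (y + u))"
    using long_tailed_local_comparison[OF q(2)] by blast
  define A where "A = Max {0, X1, X2, X3, A0}"
  have A: "A \<ge> 0" "A \<ge> X1" "A \<ge> X2" "A \<ge> X3" "A \<ge> A0" by (auto simp: A_def)
  obtain c where c: "c > 0" "\<And>y u. y \<ge> A \<Longrightarrow> u \<in> {0..A} \<Longrightarrow> q y \<le> c * q (y + u)" and qA: "q A > 0"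
    using A0[OF A(5)] by blast
  have M0: "0 \<le> M" using M[of 0] halfline_densityD(2)[OF g, of 0] by linarith
  \<comment> \<open>For \<open>x\<close> between \<open>A\<close> and \<open>2A\<close>, \<open>g\<close> may be evaluated below \<open>A\<close>, where it is compared with \<open>q\<close>
    only through its bound \<open>M\<close> and the positive lower bound \<open>q A / c\<close> of \<open>q\<close>.\<close>
  define c2 where "c2 = max (K * c) (M * c / q A)"
  define B where "B = max 1 (c + 3 * K + c2)"
  have c2: "c2 \<ge> 0" using K c by (auto simp: c2_def le_max_iff_disj)
  have "conv_iter f g n x \<le> B ^ n * q x" if "x \<ge> A" for n x
    using that
  proof (induction n arbitrary: x)
    case 0
    then show ?case using X3 A by simp
  next
    case (Suc n)
    note x = Suc.prems
    have qx: "q x \<ge> 0" "\<And>y. q y \<ge> 0" "\<And>y. g y \<ge> 0"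
      using halfline_densityD(2)[OF q(1)] halfline_densityD(2)[OF g] by auto
    have B: "B \<ge> 1" "B ^ n \<ge> 1" by (auto simp: B_def intro: one_le_power)
    have 1: "conv_on {..<A} g (conv_iter f g n) x \<le> ennreal (c2 * q x)"
    proof (rule conv_on_le_const)
      fix v assume v: "v \<in> {..<A}" "0 \<le> v"
      show "g (x - v) \<le> c2 * q x"
      proof (cases "x - v \<ge> A")
        case True
        have "g (x - v) \<le> K * q (x - v)" using True A by (intro X2) auto
        also have "\<dots> \<le> K * (c * q (x - v + v))" using True v K by (intro mult_left_mono c) auto
        also have "\<dots> \<le> c2 * q x" using qx by (simp add: c2_def mult_right_mono flip: mult.assoc)
        finally show ?thesis .
      next
        case False
        have "q A \<le> c * q (A + (x - A))" using False v x by (intro c) auto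
        then have "M \<le> M * (c * q x / q A)"
          using qA mult_left_mono[OF _ M0, of 1 "c * q x / q A"] by simp
        also have "\<dots> \<le> c2 * q x" using qx by (simp add: c2_def mult_right_mono flip: mult.assoc times_divide_eq_left)
        finally show ?thesis using M[of "x - v"] by linarith
      qed
    qed (use c2 qx halfline_density_conv_iter[OF f g M] in auto)
    have "conv_on ({..x - A} \<inter> {..<A}) q g x \<le> ennreal (c * q x)"
    proof (rule conv_on_le_const[OF g])
      fix u assume "u \<in> {..x - A} \<inter> {..<A}" "0 \<le> u"
      then show "q (x - u) \<le> c * q x" using c(2)[of "x - u" u] by auto
    qed (use c qx in auto)
    moreover have "conv_on {A..x - A} q g x \<le> ennreal (3 * K * q x)"
    proof -
      have "conv_on {A..x - A} q g x \<le> ennreal K * conv_on {A..x - A} q q x"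
      proof (rule conv_on_le_cmult)
        fix u assume "u \<in> {A..x - A}"
        then have "q (x - u) * g u \<le> q (x - u) * (K * q u)"
          using A qx by (intro mult_left_mono X2) auto
        then show "q (x - u) * g u \<le> K * (q (x - u) * q u)" by (simp add: mult_ac)
      qed (use K in auto)
      also have "\<dots> \<le> ennreal K * ennreal (3 * q x)"
        using x A by (intro mult_left_mono order_trans[OF conv_on_subset X1]) auto
      also have "\<dots> = ennreal (3 * K * q x)"
        using K by (simp add: mult_ac flip: ennreal_mult')
      finally show ?thesis .
    qed
    ultimately have "conv_on (({..x - A} \<inter> {..<A}) \<union> {A..x - A}) q g x \<le> ennreal (c * q x) + ennreal (3 * K * q x)"
      by (intro order_trans[OF conv_on_Un_le] add_mono) auto
    also have "({..x - A} \<inter> {..<A}) \<union> {A..x - A} = {..x - A}" by auto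
    finally have 2: "conv_on {..x - A} q g x \<le> ennreal (c * q x) + ennreal (3 * K * q x)" .
    have "conv_on {..x - A} (conv_iter f g n) g x \<le> ennreal (B ^ n) * conv_on {..x - A} q g x"
    proof (rule conv_on_le_cmult)
      fix u assume "u \<in> {..x - A}"
      then show "conv_iter f g n (x - u) * g u \<le> B ^ n * (q (x - u) * g u)"
        using Suc.IH[of "x - u"] qx mult_right_mono[of "conv_iter f g n (x - u)" "B ^ n * q (x - u)" "g u"]
        by (auto simp: mult.assoc)
    qed (use B in auto)
    also have "\<dots> \<le> ennreal (B ^ n) * (ennreal (c * q x) + ennreal (3 * K * q x))"
      using 2 by (rule mult_left_mono) simp
    also have "\<dots> = ennreal (B ^ n * ((c + 3 * K) * q x))"
      using c K qx B by (simp add: algebra_simps flip: ennreal_plus ennreal_mult')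
    finally have 3: "conv_on {..x - A} (conv_iter f g n) g x \<le> ennreal (B ^ n * ((c + 3 * K) * q x))" .
    have "ennreal (conv_iter f g (Suc n) x) = conv_on ({..x - A} \<union> {x - A<..}) (conv_iter f g n) g x"
    proof -
      have "{..x - A} \<union> {x - A<..} = UNIV" by auto
      then show ?thesis using conv_on_conv_iter[OF f g M] by metis
    qed
    also have "\<dots> \<le> conv_on {..x - A} (conv_iter f g n) g x + conv_on {x - A<..} (conv_iter f g n) g x"
      by (intro conv_on_Un_le) auto
    also have "conv_on {x - A<..} (conv_iter f g n) g x = conv_on {..<A} g (conv_iter f g n) x"
      by (rule conv_on_reflect) auto
    also have "conv_on {..x - A} (conv_iter f g n) g x + \<dots> \<le>
        ennreal (B ^ n * ((c + 3 * K) * q x)) + ennreal (c2 * q x)"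
      using 3 1 by (rule add_mono)
    also have "\<dots> = ennreal (B ^ n * ((c + 3 * K) * q x) + c2 * q x)"
      using c K qx B c2 by (simp flip: ennreal_plus)
    finally have "conv_iter f g (Suc n) x \<le> B ^ n * ((c + 3 * K) * q x) + c2 * q x"
      using c K qx B c2 by (subst (asm) ennreal_le_iff) auto
    also have "c2 * q x \<le> B ^ n * (c2 * q x)"
      using B c2 qx mult_right_mono[of 1 "B ^ n" "c2 * q x"] by simp
    also have "B ^ n * ((c + 3 * K) * q x) + B ^ n * (c2 * q x) = B ^ n * ((c + 3 * K + c2) * q x)"
      by (simp add: algebra_simps)
    also have "\<dots> \<le> B ^ n * (B * q x)"
      using B qx by (intro mult_left_mono mult_right_mono) (auto simp: B_def)
    finally show ?case by (simp add: mult_ac)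
  qed
  then show ?thesis by blast
qed

text \<open>Tannery's argument: finitely many terms are asymptotically known, and the geometric bound
  makes the remaining ones small uniformly in \<open>x\<close>. The two uses have \<open>q\<close> equal to \<open>g\<close> and to the
  mixture itself.\<close>

lemma poisson_mixture_asymp_le: "asymp_le (poisson_mixture l f g) l g q"
  unfolding asymp_le_def
proof (intro allI impI)
  fix \<eta> :: real assume \<eta>: "\<eta> > 0"
  obtain A B where AB: "\<And>n x. x \<ge> A \<Longrightarrow> conv_iter f g n x \<le> B ^ n * q x"
    using conv_iter_geometric_bound by blast
  let ?w = "poisson_weight l"
  have sB: "summable (\<lambda>n. ?w n * B ^ n)"
    using poisson_weight_sums by (rule sums_summable)
  have "(\<lambda>N. \<Sum>n. ?w (n + N) * B ^ (n + N)) \<longlonglongrightarrow> 0"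
    using suminf_exist_split2[OF sB] by simp
  then have "\<forall>\<^sub>F N in sequentially. (\<Sum>n. ?w (n + N) * B ^ (n + N)) < \<eta> / 2"
    using \<eta> by (intro order_tendstoD) auto
  then obtain N where N: "(\<Sum>n. ?w (n + N) * B ^ (n + N)) < \<eta> / 2"
    by (auto simp: eventually_sequentially)
  have N1: "(\<Sum>n<N. ?w n) \<le> 1"
    using poisson_weight_sums_1[of l] poisson_weight_nonneg[OF l]
    by (metis finite_lessThan sum_le_suminf sums_summable sums_unique)
  have Nl: "(\<Sum>n<N. ?w n * real n) \<le> l"
    using poisson_weight_mean_sums[of l] poisson_weight_nonneg[OF l]
    by (metis (mono_tags, lifting) finite_lessThan mult_nonneg_nonneg of_nat_0_le_iff sum_le_suminf sums_summable sums_unique)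
  have "\<forall>\<^sub>F x in at_top. \<forall>n\<in>{..<N}. conv_iter f g n x \<le> real n * g x + \<eta> / 2 * q x"
  proof (intro eventually_ball_finite finite_lessThan ballI)
    fix n
    show "\<forall>\<^sub>F x in at_top. conv_iter f g n x \<le> real n * g x + \<eta> / 2 * q x"
      using conv_iter_asymp_le[of n] \<eta> unfolding asymp_le_def by (meson half_gt_zero)
  qed
  then show "\<forall>\<^sub>F x in at_top. poisson_mixture l f g x \<le> l * g x + \<eta> * q x"
    using eventually_ge_at_top[of A]
  proof eventually_elim
    case (elim x)
    have qx: "q x \<ge> 0" "g x \<ge> 0" using halfline_densityD(2)[OF q(1)] halfline_densityD(2)[OF g] by auto
    have "poisson_mixture l f g x = (\<Sum>n. ?w (n + N) * conv_iter f g (n + N) x) + (\<Sum>n<N. ?w n * conv_iter f g n x)"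
      unfolding poisson_mixture_def by (rule suminf_split_initial_segment[OF poisson_mixture_summable])
    also have "(\<Sum>n. ?w (n + N) * conv_iter f g (n + N) x) \<le> (\<Sum>n. ?w (n + N) * B ^ (n + N) * q x)"
    proof (rule suminf_le)
      show "?w (n + N) * conv_iter f g (n + N) x \<le> ?w (n + N) * B ^ (n + N) * q x" for n
        using AB[OF elim(2)] poisson_weight_nonneg[OF l] by (simp add: mult.assoc mult_left_mono)
      show "summable (\<lambda>n. ?w (n + N) * conv_iter f g (n + N) x)"
        using poisson_mixture_summable by (subst summable_iff_shift)
      show "summable (\<lambda>n. ?w (n + N) * B ^ (n + N) * q x)"
        by (intro summable_mult2) (use sB in \<open>subst summable_iff_shift\<close>)
    qed
    also have "\<dots> = (\<Sum>n. ?w (n + N) * B ^ (n + N)) * q x"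
      by (intro suminf_mult2[symmetric]) (use sB in \<open>subst summable_iff_shift\<close>)
    also have "\<dots> \<le> \<eta> / 2 * q x" using N qx by (intro mult_right_mono) auto
    also have "(\<Sum>n<N. ?w n * conv_iter f g n x) \<le> (\<Sum>n<N. ?w n * (real n * g x + \<eta> / 2 * q x))"
      using elim poisson_weight_nonneg[OF l] by (intro sum_mono mult_left_mono) auto
    also have "\<dots> = (\<Sum>n<N. ?w n * real n) * g x + (\<Sum>n<N. ?w n) * (\<eta> / 2 * q x)"
      by (simp add: sum_distrib_right sum.distrib distrib_left mult.assoc)
    also have "\<dots> \<le> l * g x + 1 * (\<eta> / 2 * q x)"
      using N1 Nl qx \<eta> by (intro add_mono mult_right_mono) auto
    finally show ?case by simp
  qed
qed

end

end

section \<open>Weighted masses and the possible tail ratios\<close>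

text \<open>For independent \<open>X\<close> and \<open>Y\<close> with these densities, \<open>W (X + Y) \<le> W X * W Y\<close>, and the
  expectation of the product factorizes.\<close>

lemma nn_integral_density_conv_submult:
  fixes W :: "real \<Rightarrow> real"
  assumes a: "halfline_density a" and b: "halfline_density b" and M: "\<And>x. b x \<le> M"
    and W [measurable]: "W \<in> borel_measurable borel" and W0: "\<And>x. W x \<ge> 0"
    and sub: "\<And>x y. x \<ge> 0 \<Longrightarrow> y \<ge> 0 \<Longrightarrow> W (x + y) \<le> W x * W y"
  shows "(\<integral>\<^sup>+ x. ennreal (density_conv a b x) * ennreal (W x) \<partial>lborel) \<le>
    (\<integral>\<^sup>+ x. ennreal (a x) * ennreal (W x) \<partial>lborel) * (\<integral>\<^sup>+ x. ennreal (b x) * ennreal (W x) \<partial>lborel)"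
proof -
  note [measurable] = halfline_densityD(1)[OF a] halfline_densityD(1)[OF b]
    halfline_densityD(1)[OF halfline_density_conv[OF a b M]]
  interpret A: prob_space "density lborel (\<lambda>x. ennreal (a x))" by (rule halfline_density_prob_space[OF a])
  interpret B: prob_space "density lborel (\<lambda>x. ennreal (b x))" by (rule halfline_density_prob_space[OF b])
  have "(\<integral>\<^sup>+ x. ennreal (density_conv a b x) * ennreal (W x) \<partial>lborel) =
      (\<integral>\<^sup>+ x. ennreal (W x) \<partial>density lborel (\<lambda>x. ennreal (density_conv a b x)))"
    by (subst nn_integral_density) auto
  also have "\<dots> = (\<integral>\<^sup>+ x. \<integral>\<^sup>+ y. ennreal (W (x + y)) \<partial>density lborel (\<lambda>x. ennreal (b x))
      \<partial>density lborel (\<lambda>x. ennreal (a x)))"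
    unfolding density_conv_eq_convolution[OF a b M]
    by (intro nn_integral_convolution A.finite_measure_axioms B.finite_measure_axioms) auto
  also have "\<dots> = (\<integral>\<^sup>+ x. ennreal (a x) * (\<integral>\<^sup>+ y. ennreal (b y) * ennreal (W (x + y)) \<partial>lborel) \<partial>lborel)"
    by (simp add: nn_integral_density)
  also have "\<dots> \<le> (\<integral>\<^sup>+ x. ennreal (a x) * (\<integral>\<^sup>+ y. ennreal (W x) * (ennreal (b y) * ennreal (W y)) \<partial>lborel) \<partial>lborel)"
  proof (rule nn_integral_mono)
    fix x
    show "ennreal (a x) * (\<integral>\<^sup>+ y. ennreal (b y) * ennreal (W (x + y)) \<partial>lborel)
        \<le> ennreal (a x) * (\<integral>\<^sup>+ y. ennreal (W x) * (ennreal (b y) * ennreal (W y)) \<partial>lborel)"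
    proof (cases "x < 0")
      case True
      then show ?thesis using halfline_densityD(3)[OF a] by simp
    next
      case False
      have "ennreal (b y) * ennreal (W (x + y)) \<le> ennreal (W x) * (ennreal (b y) * ennreal (W y))" for y
      proof (cases "y < 0")
        case True
        then show ?thesis using halfline_densityD(3)[OF b] by simp
      next
        case F: False
        have "ennreal (b y) * ennreal (W (x + y)) \<le> ennreal (b y) * ennreal (W x * W y)"
          using False F by (intro mult_left_mono ennreal_leI sub) auto
        then show ?thesis using W0 by (simp add: ennreal_mult mult_ac)
      qed
      then show ?thesis by (intro mult_left_mono nn_integral_mono) auto
    qed
  qed
  also have "\<dots> = (\<integral>\<^sup>+ x. (ennreal (a x) * ennreal (W x)) * (\<integral>\<^sup>+ y. ennreal (b y) * ennreal (W y) \<partial>lborel) \<partial>lborel)"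
    by (simp add: nn_integral_cmult mult.assoc)
  also have "\<dots> = (\<integral>\<^sup>+ x. ennreal (a x) * ennreal (W x) \<partial>lborel) * (\<integral>\<^sup>+ x. ennreal (b x) * ennreal (W x) \<partial>lborel)"
    by (rule nn_integral_multc) measurable
  finally show ?thesis .
qed

lemma halfline_density_integrable_mult:
  assumes a: "halfline_density a" and [measurable]: "W \<in> borel_measurable borel"
    and W: "\<And>x. x \<ge> 0 \<Longrightarrow> \<bar>W x\<bar> \<le> (C::real)"
  shows "integrable lborel (\<lambda>x. a x * W x)"
proof (rule Bochner_Integration.integrable_bound)
  note [measurable] = halfline_densityD(1)[OF a]
  have "integrable lborel a"
    using halfline_densityD(2,4)[OF a] by (intro integrableI_nonneg) auto
  then show "integrable lborel (\<lambda>x. C * a x)" by simp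
  show "(\<lambda>x. a x * W x) \<in> borel_measurable lborel" by measurable
  show "AE x in lborel. norm (a x * W x) \<le> norm (C * a x)"
  proof (rule AE_I2)
    fix x
    show "norm (a x * W x) \<le> norm (C * a x)"
    proof (cases "x < 0")
      case False
      then have "\<bar>W x\<bar> \<le> \<bar>C\<bar>" using W[of x] by linarith
      then have "\<bar>a x\<bar> * \<bar>W x\<bar> \<le> \<bar>a x\<bar> * \<bar>C\<bar>" by (rule mult_left_mono) simp
      then show ?thesis by (simp add: abs_mult mult.commute)
    qed (use halfline_densityD(3)[OF a] in simp)
  qed
qed

lemma halfline_density_integral:
  assumes a: "halfline_density a"
  shows "(LINT x|lborel. a x) = 1" "integrable lborel a"
  using halfline_densityD[OF a] by (auto simp: integral_eq_nn_integral intro!: integrableI_nonneg)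

text \<open>The weight is submultiplicative on the half line, like an exponential, but bounded, so
  that all weighted masses are finite. The weighted mass of a heavy-tailed density can be tuned
  by the choice of the cap.\<close>

definition capped_exp :: "real \<Rightarrow> real \<Rightarrow> real \<Rightarrow> real" where
  "capped_exp e T x = exp (e * min x T)"

lemma capped_exp_measurable [measurable]: "capped_exp e T \<in> borel_measurable borel"
  unfolding capped_exp_def[abs_def] by measurable

lemma capped_exp_bounds:
  assumes "e \<ge> 0" "T \<ge> 0" "x \<ge> 0"
  shows "1 \<le> capped_exp e T x" "capped_exp e T x \<le> exp (e * T)" "capped_exp e T x \<le> exp (e * x)"
  using assms by (auto simp: capped_exp_def intro: mult_left_mono)

lemma capped_exp_submult:
  assumes "e \<ge> 0" "T \<ge> 0" "x \<ge> 0" "y \<ge> 0"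
  shows "capped_exp e T (x + y) \<le> capped_exp e T x * capped_exp e T y"
  using assms by (auto simp: capped_exp_def min_def simp flip: exp_add distrib_left intro!: mult_left_mono)

lemma capped_exp_integrable:
  assumes "halfline_density a" "e \<ge> 0" "T \<ge> 0"
  shows "integrable lborel (\<lambda>x. a x * capped_exp e T x)"
  by (rule halfline_density_integrable_mult[OF assms(1), where C = "exp (e * T)"])
     (use capped_exp_bounds[OF assms(2,3)] in \<open>auto simp: capped_exp_def\<close>)

text \<open>A long-tailed density has no exponential moment, so the weighted mass of \<open>g\<close> grows from 1
  to infinity with the cap, even for very small \<open>e\<close>. Raising the cap by 1 multiplies it by at
  most \<open>exp e\<close>, so the first integer cap that reaches \<open>1 + \<delta>\<close> overshoots by at most this factor.\<close>

lemma capped_exp_level: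
  assumes g: "halfline_density g" and gL: "long_tailed g" and e: "e > 0" and \<delta>: "\<delta> > 0"
  shows "\<exists>T\<ge>0. 1 + \<delta> \<le> (LINT x|lborel. g x * capped_exp e T x) \<and>
    (LINT x|lborel. g x * capped_exp e T x) \<le> exp e * (1 + \<delta>)"
proof -
  note [measurable] = halfline_densityD(1)[OF g]
  define \<phi> where "\<phi> n = (LINT x|lborel. g x * capped_exp e (real n) x)" for n
  have int: "integrable lborel (\<lambda>x. g x * capped_exp e (real n) x)" for n
    using e by (intro capped_exp_integrable g) auto
  obtain c where c: "c > 0" "\<forall>\<^sub>F x in at_top. c * exp (- (e / 2) * x) \<le> g x"
    using long_tailed_lower_exp[OF gL, of "e / 2"] e by auto
  then obtain X where X: "\<And>x. x \<ge> X \<Longrightarrow> c * exp (- (e / 2) * x) \<le> g x"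
    unfolding eventually_at_top_linorder by auto
  have big: "c * exp (- (e / 2)) * exp (e / 2 * real n) \<le> \<phi> n" if n: "real n \<ge> X" for n
  proof -
    let ?k = "c * exp (- (e / 2)) * exp (e / 2 * real n)"
    have "(LINT x|lborel. indicator {real n..real n + 1} x * ?k) \<le> \<phi> n"
      unfolding \<phi>_def
    proof (rule integral_mono)
      show "integrable lborel (\<lambda>x. indicator {real n..real n + 1} x * ?k)"
        by (intro integrable_mult_left integrable_real_indicator) (auto simp: emeasure_lborel_Icc_eq)
      show "indicator {real n..real n + 1} x * ?k \<le> g x * capped_exp e (real n) x" for x
      proof (cases "x \<in> {real n..real n + 1}")
        case True
        have "?k = c * exp (- (e / 2) * (real n + 1)) * exp (e * real n)"
          by (simp add: field_simps flip: exp_add)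
        also have "\<dots> \<le> c * exp (- (e / 2) * x) * exp (e * real n)"
          using True c e by (intro mult_left_mono mult_right_mono) (auto intro!: mult_left_mono)
        also have "\<dots> \<le> g x * exp (e * real n)"
          using True n by (intro mult_right_mono X) auto
        also have "exp (e * real n) = capped_exp e (real n) x"
          using True by (simp add: capped_exp_def min_def)
        finally show ?thesis using True by simp
      qed (use halfline_densityD(2)[OF g] in \<open>simp add: capped_exp_def\<close>)
    qed (rule int)
    then show ?thesis by simp
  qed
  have "filterlim (\<lambda>n. c * exp (- (e / 2)) * exp (e / 2 * real n)) at_top sequentially"
    using c e by (intro filterlim_tendsto_pos_mult_at_top[OF tendsto_const]
      filterlim_compose[OF exp_at_top] filterlim_real_sequentially) auto
  then have "\<forall>\<^sub>F n in sequentially. 1 + \<delta> \<le> c * exp (- (e / 2)) * exp (e / 2 * real n)"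
    by (simp add: filterlim_at_top)
  moreover have "\<forall>\<^sub>F n in sequentially. real n \<ge> X"
    using filterlim_real_sequentially by (simp add: filterlim_at_top)
  ultimately have "\<forall>\<^sub>F n in sequentially. 1 + \<delta> \<le> \<phi> n"
    by eventually_elim (use big in force)
  then have ex: "\<exists>n. 1 + \<delta> \<le> \<phi> n" by (auto simp: eventually_sequentially)
  define n where "n = (LEAST n. 1 + \<delta> \<le> \<phi> n)"
  have n: "1 + \<delta> \<le> \<phi> n" unfolding n_def using ex by (rule LeastI_ex)
  have "\<phi> 0 = (LINT x|lborel. g x)"
    unfolding \<phi>_def
  proof (intro Bochner_Integration.integral_cong refl)
    fix x show "g x * capped_exp e (real 0) x = g x"
      using halfline_densityD(3)[OF g, of x] by (cases "x < 0") (auto simp: capped_exp_def)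
  qed
  then have "\<phi> 0 = 1" using halfline_density_integral[OF g] by simp
  with n \<delta> have "n \<noteq> 0" by (metis add_le_same_cancel1 linorder_not_less)
  then obtain m where m: "n = Suc m" by (cases n) auto
  have "\<phi> m < 1 + \<delta>"
    using not_less_Least[of m "\<lambda>n. 1 + \<delta> \<le> \<phi> n"] m by (auto simp: n_def)
  moreover have "\<phi> n \<le> exp e * \<phi> m"
  proof -
    have "\<phi> n \<le> (LINT x|lborel. exp e * (g x * capped_exp e (real m) x))"
      unfolding \<phi>_def
    proof (rule integral_mono)
      fix x
      have "e * min x (real n) \<le> e + e * min x (real m)"
        using e m mult_left_mono[of "min x (real n)" "1 + min x (real m)" e]
        by (auto simp: distrib_left)
      then have "capped_exp e (real n) x \<le> exp e * capped_exp e (real m) x"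
        by (simp add: capped_exp_def flip: exp_add)
      then have "g x * capped_exp e (real n) x \<le> g x * (exp e * capped_exp e (real m) x)"
        using halfline_densityD(2)[OF g] by (intro mult_left_mono)
      then show "g x * capped_exp e (real n) x \<le> exp e * (g x * capped_exp e (real m) x)"
        by (simp add: mult_ac)
    qed (use int in auto)
    then show ?thesis by (simp add: \<phi>_def)
  qed
  moreover have "exp e * \<phi> m \<le> exp e * (1 + \<delta>)" using \<open>\<phi> m < 1 + \<delta>\<close> by simp
  ultimately have "\<phi> n \<le> exp e * (1 + \<delta>)" by linarith
  then show ?thesis using n unfolding \<phi>_def by (intro exI[of _ "real n"]) auto
qed

lemma le_if_scaled_le_exp_minus_1:
  fixes D l :: real
  assumes l: "l \<ge> 0" and le: "\<And>\<delta>. \<delta> > 0 \<Longrightarrow> D * \<delta> \<le> exp (l * \<delta>) - 1"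
  shows "D \<le> l"
proof (rule field_le_epsilon)
  fix \<epsilon> :: real assume \<epsilon>: "\<epsilon> > 0"
  define \<delta> where "\<delta> = min (1 / (l + 1)) (\<epsilon> / (l^2 + 1))"
  have \<delta>: "\<delta> > 0" "\<delta> \<le> 1 / (l + 1)" "\<delta> \<le> \<epsilon> / (l^2 + 1)"
    using l \<epsilon> by (auto simp: \<delta>_def intro!: divide_pos_pos add_nonneg_pos)
  have "l * \<delta> \<le> l * (1 / (l + 1))" using \<delta> l by (intro mult_left_mono)
  also have "\<dots> \<le> 1" using l by (simp add: field_simps)
  finally have "exp (l * \<delta>) \<le> 1 + l * \<delta> + (l * \<delta>)^2" using l \<delta> by (intro exp_bound) auto
  with le[OF \<delta>(1)] have "\<delta> * D \<le> \<delta> * (l + l^2 * \<delta>)" by (simp add: power2_eq_square algebra_simps)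
  then have "D \<le> l + l^2 * \<delta>" using \<delta> by simp
  also have "l^2 * \<delta> \<le> (l^2 + 1) * (\<epsilon> / (l^2 + 1))"
    using \<delta> by (intro mult_mono) auto
  also have "\<dots> = \<epsilon>" by (simp add: add_nonneg_pos order_less_imp_not_eq2)
  finally show "D \<le> l + \<epsilon>" by simp
qed

context
  fixes l M :: real and f g :: "real \<Rightarrow> real"
  assumes l: "l \<ge> 0" and f: "halfline_density f" and g: "halfline_density g"
    and M: "\<And>x. g x \<le> M"
begin

lemma poisson_mixture_weighted_mass_le:
  fixes W :: "real \<Rightarrow> real"
  assumes W [measurable]: "W \<in> borel_measurable borel" and W0: "\<And>x. W x \<ge> 0"
    and sub: "\<And>x y. x \<ge> 0 \<Longrightarrow> y \<ge> 0 \<Longrightarrow> W (x + y) \<le> W x * W y"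
    and F: "(\<integral>\<^sup>+ x. ennreal (f x) * ennreal (W x) \<partial>lborel) \<le> ennreal F" "F \<ge> 0"
    and G: "(\<integral>\<^sup>+ x. ennreal (g x) * ennreal (W x) \<partial>lborel) \<le> ennreal G" "G \<ge> 0"
  shows "(\<integral>\<^sup>+ x. ennreal (poisson_mixture l f g x) * ennreal (W x) \<partial>lborel) \<le> ennreal (F * exp (l * (G - 1)))"
proof -
  note [measurable] = conv_iter_measurable[OF l f g M]
  have c: "(\<integral>\<^sup>+ x. ennreal (conv_iter f g n x) * ennreal (W x) \<partial>lborel) \<le> ennreal (F * G ^ n)" for n
  proof (induction n)
    case 0
    then show ?case using F by simp
  next
    case (Suc n)
    have "(\<integral>\<^sup>+ x. ennreal (conv_iter f g (Suc n) x) * ennreal (W x) \<partial>lborel) \<le>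
        (\<integral>\<^sup>+ x. ennreal (conv_iter f g n x) * ennreal (W x) \<partial>lborel) *
        (\<integral>\<^sup>+ x. ennreal (g x) * ennreal (W x) \<partial>lborel)"
      unfolding conv_iter.simps
      by (rule nn_integral_density_conv_submult[OF halfline_density_conv_iter[OF f g M] g M W W0 sub])
    also have "\<dots> \<le> ennreal (F * G ^ n) * ennreal G"
      using Suc G(1) by (rule mult_mono) auto
    also have "\<dots> = ennreal (F * G ^ Suc n)"
      using F G by (simp add: mult_ac flip: ennreal_mult)
    finally show ?case .
  qed
  have sums: "(\<lambda>n. F * (poisson_weight l n * G ^ n)) sums (F * exp (l * (G - 1)))"
    by (intro sums_mult poisson_weight_sums)
  have "(\<integral>\<^sup>+ x. ennreal (poisson_mixture l f g x) * ennreal (W x) \<partial>lborel) =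
      (\<integral>\<^sup>+ x. (\<Sum>n. ennreal (poisson_weight l n) * (ennreal (conv_iter f g n x) * ennreal (W x))) \<partial>lborel)"
    unfolding ennreal_poisson_mixture[OF l f g M] by (simp add: mult.assoc flip: ennreal_suminf_multc)
  also have "\<dots> = (\<Sum>n. ennreal (poisson_weight l n) * (\<integral>\<^sup>+ x. ennreal (conv_iter f g n x) * ennreal (W x) \<partial>lborel))"
    by (subst nn_integral_suminf) (auto intro!: suminf_cong nn_integral_cmult)
  also have "\<dots> \<le> (\<Sum>n. ennreal (poisson_weight l n) * ennreal (F * G ^ n))"
    by (intro suminf_le mult_left_mono c) auto
  also have "\<dots> = (\<Sum>n. ennreal (F * (poisson_weight l n * G ^ n)))"
    using F G poisson_weight_nonneg[OF l] by (simp add: mult_ac flip: ennreal_mult)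
  also have "\<dots> = ennreal (F * exp (l * (G - 1)))"
    using sums F G poisson_weight_nonneg[OF l]
    by (subst suminf_ennreal2) (auto simp: sums_iff)
  finally show ?thesis .
qed

context
  fixes b :: real
  assumes gL: "long_tailed g" and b: "b > 0" and fb: "integrable lborel (\<lambda>x. f x * exp (b * x))"
begin

text \<open>The excess \<open>W - 1\<close> of the weight is small on \<open>[0, A]\<close>, so the excess mass \<open>\<delta>\<close> of \<open>g\<close> sits
  beyond \<open>A\<close>, where the mixture is at least \<open>D * g\<close>: the excess mass of the mixture is at least
  about \<open>D * \<delta>\<close>. On the other hand, submultiplicativity and the Poisson generating function
  bound it by about \<open>exp (l * \<delta>) - 1\<close>.\<close>

lemma capped_exp_comparison:
  assumes D: "D \<ge> 0" and A: "A \<ge> 0" "\<And>x. x \<ge> A \<Longrightarrow> D * g x \<le> poisson_mixture l f g x"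
    and e: "0 < e" "e \<le> b" and \<delta>: "\<delta> > 0"
  shows "D * \<delta> - D * (exp (e * A) - 1) \<le>
    (LINT x|lborel. f x * exp (e * x)) * exp (l * (exp e * (1 + \<delta>) - 1)) - 1"
proof -
  let ?p = "poisson_mixture l f g"
  have p: "halfline_density ?p" by (rule halfline_density_poisson_mixture[OF l f g M])
  note [measurable] = halfline_densityD(1)[OF f]
  obtain T where T: "T \<ge> 0" "1 + \<delta> \<le> (LINT x|lborel. g x * capped_exp e T x)"
    "(LINT x|lborel. g x * capped_exp e T x) \<le> exp e * (1 + \<delta>)"
    using capped_exp_level[OF g gL e(1) \<delta>] by blast
  define W where "W = capped_exp e T"
  define F where "F = (LINT x|lborel. f x * exp (e * x))"
  define G where "G = (LINT x|lborel. g x * W x)"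
  have W [measurable]: "W \<in> borel_measurable borel" by (simp add: W_def)
  have W0: "W x \<ge> 0" for x by (simp add: W_def capped_exp_def)
  have W1: "1 \<le> W x" "W x \<le> exp (e * x)" if "x \<ge> 0" for x
    using capped_exp_bounds that e T by (auto simp: W_def)
  have int: "integrable lborel (\<lambda>x. a x * W x)" if "halfline_density a" for a
    unfolding W_def using that e T by (intro capped_exp_integrable) auto
  have int_ex: "integrable lborel (\<lambda>x. f x * exp (e * x))"
  proof (rule Bochner_Integration.integrable_bound[OF fb])
    show "AE x in lborel. norm (f x * exp (e * x)) \<le> norm (f x * exp (b * x))"
    proof (rule AE_I2)
      fix x show "norm (f x * exp (e * x)) \<le> norm (f x * exp (b * x))"
        using halfline_densityD(2,3)[OF f, of x] e
        by (cases "x < 0") (auto simp: abs_mult intro!: mult_left_mono mult_right_mono)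
    qed
  qed measurable
  have nn: "(\<integral>\<^sup>+ x. ennreal (a x) * ennreal (W x) \<partial>lborel) = ennreal (LINT x|lborel. a x * W x)"
    if a: "halfline_density a" for a
    using int[OF a] halfline_densityD(2)[OF a] W0
    by (subst nn_integral_eq_integral[symmetric]) (auto simp: ennreal_mult)
  have "ennreal (LINT x|lborel. ?p x * W x) \<le> ennreal (F * exp (l * (G - 1)))"
    unfolding nn[OF p, symmetric]
  proof (rule poisson_mixture_weighted_mass_le[OF W W0])
    show "W (x + y) \<le> W x * W y" if "x \<ge> 0" "y \<ge> 0" for x y
      unfolding W_def using that e T by (intro capped_exp_submult) auto
    show "(\<integral>\<^sup>+ x. ennreal (g x) * ennreal (W x) \<partial>lborel) \<le> ennreal G"
      unfolding nn[OF g] G_def by simp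
    show "(\<integral>\<^sup>+ x. ennreal (f x) * ennreal (W x) \<partial>lborel) \<le> ennreal F"
      unfolding nn[OF f] F_def
    proof (intro ennreal_leI integral_mono int f int_ex)
      fix x show "f x * W x \<le> f x * exp (e * x)"
        using halfline_densityD(2,3)[OF f, of x] W1[of x]
        by (cases "x < 0") (auto intro!: mult_left_mono)
    qed
    show "F \<ge> 0" unfolding F_def using halfline_densityD(2)[OF f] by (intro integral_nonneg_AE) auto
    show "G \<ge> 0" unfolding G_def using halfline_densityD(2)[OF g] W0 by (intro integral_nonneg_AE) auto
  qed
  moreover have F0: "F \<ge> 0" unfolding F_def using halfline_densityD(2)[OF f] by (intro integral_nonneg_AE) auto
  ultimately have P: "(LINT x|lborel. ?p x * W x) \<le> F * exp (l * (G - 1))"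
    by (subst (asm) ennreal_le_iff) auto
  also have "\<dots> \<le> F * exp (l * (exp e * (1 + \<delta>) - 1))"
    using F0 l T(3) by (auto simp: G_def W_def intro!: mult_left_mono)
  finally have P: "(LINT x|lborel. ?p x * W x) \<le> F * exp (l * (exp e * (1 + \<delta>) - 1))" .
  have "(LINT x|lborel. D * (g x * W x) - D * exp (e * A) * g x) \<le> (LINT x|lborel. ?p x * W x - ?p x)"
  proof (rule integral_mono)
    show "integrable lborel (\<lambda>x. D * (g x * W x) - D * exp (e * A) * g x)"
      using int[OF g] halfline_density_integral(2)[OF g] by auto
    show "integrable lborel (\<lambda>x. ?p x * W x - ?p x)"
      using int[OF p] halfline_density_integral(2)[OF p] by auto
    fix x
    show "D * (g x * W x) - D * exp (e * A) * g x \<le> ?p x * W x - ?p x"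
    proof (cases "x < 0")
      case True
      then show ?thesis using halfline_densityD(3)[OF p True] halfline_densityD(3)[OF g True] by simp
    next
      case False
      note x = this
      show ?thesis
      proof (cases "x < A")
        case True
        have "W x \<le> exp (e * x)" using W1 x by simp
        also have "\<dots> \<le> exp (e * A)" using True e by simp
        finally have "D * g x * W x \<le> D * g x * exp (e * A)"
          using D halfline_densityD(2)[OF g] by (intro mult_left_mono) auto
        moreover have "?p x * 1 \<le> ?p x * W x"
          using W1 x halfline_densityD(2)[OF p] by (intro mult_left_mono) auto
        ultimately show ?thesis by (simp add: mult_ac)
      next
        case False
        have "D * g x * (W x - 1) \<le> ?p x * (W x - 1)"
          using False W1[of x] x by (intro mult_right_mono A) auto
        moreover have "D * g x * 1 \<le> D * g x * exp (e * A)"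
          using D halfline_densityD(2)[OF g] e A by (intro mult_left_mono) auto
        ultimately show ?thesis by (simp add: algebra_simps)
      qed
    qed
  qed
  also have "(LINT x|lborel. ?p x * W x - ?p x) = (LINT x|lborel. ?p x * W x) - 1"
    using int[OF p] halfline_density_integral[OF p] by simp
  also have "(LINT x|lborel. D * (g x * W x) - D * exp (e * A) * g x) = D * G - D * exp (e * A)"
    using int[OF g] halfline_density_integral[OF g] by (simp add: G_def)
  finally have "D * G - D * exp (e * A) \<le> (LINT x|lborel. ?p x * W x) - 1" .
  moreover have "D * (1 + \<delta>) \<le> D * G" using D T(2) by (intro mult_left_mono) (auto simp: G_def W_def)
  ultimately show ?thesis using P by (simp add: F_def algebra_simps)
qed

text \<open>For \<open>e\<close> tending to 0, the comparison of weighted masses becomes \<open>D * \<delta> \<le> exp (l * \<delta>) - 1\<close>,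
  for every \<open>\<delta> > 0\<close>; at first order in \<open>\<delta>\<close> this says \<open>D \<le> l\<close>. So although the lower bound \<open>l\<close> on
  the tail ratio comes from the ends of the convolutions only, the ratio cannot tend to anything
  larger.\<close>

lemma poisson_mixture_ratio_le:
  assumes D: "asymp_ge (poisson_mixture l f g) D g"
  shows "D \<le> l"
proof (rule dense_le)
  fix D' assume D': "D' < D"
  show "D' \<le> l"
  proof (cases "D' \<le> 0")
    case True
    then show ?thesis using l by simp
  next
    case False
    have "\<forall>\<^sub>F x in at_top. D' * g x \<le> poisson_mixture l f g x"
      using D D' unfolding asymp_ge_def by blast
    then obtain A0 where A0: "\<And>x. x \<ge> A0 \<Longrightarrow> D' * g x \<le> poisson_mixture l f g x"
      unfolding eventually_at_top_linorder by blast
    define A where "A = max 0 A0"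
    note [measurable] = halfline_densityD(1)[OF f]
    show ?thesis
    proof (rule le_if_scaled_le_exp_minus_1[OF l])
      fix \<delta> :: real assume \<delta>: "\<delta> > 0"
      define e where "e k = b / real (Suc k)" for k
      have e: "0 < e k" "e k \<le> b" for k
        using b by (auto simp: e_def field_simps)
      have e0: "e \<longlonglongrightarrow> 0"
        unfolding e_def[abs_def] using LIMSEQ_Suc[OF lim_const_over_n[of b]] by simp
      have "(\<lambda>k. LINT x|lborel. f x * exp (e k * x)) \<longlonglongrightarrow> (LINT x|lborel. f x)"
      proof (rule integral_dominated_convergence[OF _ _ fb])
        show "AE x in lborel. (\<lambda>k. f x * exp (e k * x)) \<longlonglongrightarrow> f x"
        proof (rule AE_I2)
          fix x
          have "(\<lambda>k. f x * exp (e k * x)) \<longlonglongrightarrow> f x * exp (0 * x)"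
            by (intro tendsto_intros e0)
          then show "(\<lambda>k. f x * exp (e k * x)) \<longlonglongrightarrow> f x" by simp
        qed
        show "AE x in lborel. norm (f x * exp (e k * x)) \<le> f x * exp (b * x)" for k
        proof (rule AE_I2)
          fix x show "norm (f x * exp (e k * x)) \<le> f x * exp (b * x)"
            using halfline_densityD(2,3)[OF f, of x] e[of k]
            by (cases "x < 0") (auto simp: abs_mult intro!: mult_left_mono mult_right_mono)
        qed
      qed measurable
      then have F: "(\<lambda>k. LINT x|lborel. f x * exp (e k * x)) \<longlonglongrightarrow> 1"
        using halfline_density_integral[OF f] by simp
      have lim_right: "(\<lambda>k. (LINT x|lborel. f x * exp (e k * x)) * exp (l * (exp (e k) * (1 + \<delta>) - 1)) - 1)
          \<longlonglongrightarrow> 1 * exp (l * (exp 0 * (1 + \<delta>) - 1)) - 1"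
        by (intro tendsto_intros F e0)
      have lim_left: "(\<lambda>k. D' * \<delta> - D' * (exp (e k * A) - 1)) \<longlonglongrightarrow> D' * \<delta> - D' * (exp (0 * A) - 1)"
        by (intro tendsto_intros e0)
      have "D' * \<delta> - D' * (exp (0 * A) - 1) \<le> 1 * exp (l * (exp 0 * (1 + \<delta>) - 1)) - 1"
      proof (rule LIMSEQ_le[OF lim_left lim_right], intro exI[of _ 0] allI impI)
        fix k
        show "D' * \<delta> - D' * (exp (e k * A) - 1) \<le>
            (LINT x|lborel. f x * exp (e k * x)) * exp (l * (exp (e k) * (1 + \<delta>) - 1)) - 1"
          using False A0 \<delta> e by (intro capped_exp_comparison) (auto simp: A_def)
      qed
      then show "D' * \<delta> \<le> exp (l * \<delta>) - 1" by simp
    qed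
  qed
qed

end

text \<open>All terms of the mixture attain at least their share of \<open>l * g x\<close>, and together they do
  not exceed it; so no single term does. The term with \<open>n = 2\<close> is the convolution of \<open>g\<close> with
  the density \<open>conv_iter f g 1\<close>, which is asymptotically at least \<open>g\<close>.\<close>

lemma mid_small_if_poisson_mixture_le:
  assumes gL: "long_tailed g" and l0: "l > 0" and le: "asymp_le (poisson_mixture l f g) l g g"
  shows "mid_small g"
proof (rule mid_small_if_conv_le)
  let ?c = "conv_iter f g" and ?w = "poisson_weight l"
  show "halfline_density (?c 1)" by (rule halfline_density_conv_iter[OF f g M])
  show "asymp_ge (?c 1) 1 g" using conv_iter_asymp_ge[OF l f g M gL, of 1] by simp
  show "asymp_ge g 1 g" by (rule asymp_ge_refl) (rule halfline_densityD(2)[OF g])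
  fix \<eta> :: real assume \<eta>: "\<eta> > 0"
  have w2: "?w 2 > 0" using l0 by (simp add: poisson_weight_def)
  \<comment> \<open>An error \<open>\<theta>\<close> arises from the upper bound on the mixture, from the lower bounds on the other
    terms, and from the truncation of the series.\<close>
  define \<theta> where "\<theta> = \<eta> * ?w 2 / 3"
  have \<theta>: "\<theta> > 0" using \<eta> w2 by (simp add: \<theta>_def)
  have "(\<lambda>N. \<Sum>n<N. ?w n * real n) \<longlonglongrightarrow> l"
    using poisson_weight_mean_sums[of l] by (simp add: sums_def)
  then have "\<forall>\<^sub>F N in sequentially. l - \<theta> < (\<Sum>n<N. ?w n * real n)"
    using \<theta> by (intro order_tendstoD) auto
  then have "\<forall>\<^sub>F N in sequentially. l - \<theta> < (\<Sum>n<N. ?w n * real n) \<and> N > 2"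
    using eventually_gt_at_top[of 2] by (rule eventually_conj)
  then obtain N where N: "l - \<theta> < (\<Sum>n<N. ?w n * real n)" "N > 2"
    by (auto simp: eventually_sequentially)
  have "(\<Sum>n<N. ?w n) \<le> 1"
    using poisson_weight_sums_1[of l] poisson_weight_nonneg[OF l]
    by (metis finite_lessThan sum_le_suminf sums_summable sums_unique)
  moreover have "(\<Sum>n\<in>{..<N} - {2}. ?w n) \<le> (\<Sum>n<N. ?w n)"
    using poisson_weight_nonneg[OF l] by (intro sum_mono2) auto
  ultimately have N1: "(\<Sum>n\<in>{..<N} - {2}. ?w n) \<le> 1" by linarith
  have "\<forall>\<^sub>F x in at_top. \<forall>n\<in>{..<N}. (real n - \<theta>) * g x \<le> ?c n x"
  proof (intro eventually_ball_finite finite_lessThan ballI)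
    fix n
    show "\<forall>\<^sub>F x in at_top. (real n - \<theta>) * g x \<le> ?c n x"
      using conv_iter_asymp_ge[OF l f g M gL, of n] \<theta> unfolding asymp_ge_def by simp
  qed
  moreover have "\<forall>\<^sub>F x in at_top. poisson_mixture l f g x \<le> l * g x + \<theta> * g x"
    using le \<theta> unfolding asymp_le_def by blast
  ultimately show "\<forall>\<^sub>F x in at_top. conv_on UNIV (?c 1) g x \<le> ennreal ((2 + \<eta>) * g x)"
  proof eventually_elim
    case (elim x)
    have gx: "g x \<ge> 0" by (rule halfline_densityD(2)[OF g])
    have "?w 2 * ?c 2 x + (\<Sum>n\<in>{..<N} - {2}. ?w n * ?c n x) = (\<Sum>n<N. ?w n * ?c n x)"
      using N(2) by (subst sum.remove[of _ 2]) auto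
    also have "\<dots> \<le> poisson_mixture l f g x"
      unfolding poisson_mixture_def
      by (intro sum_le_suminf poisson_mixture_summable[OF l f g M])
         (auto intro: mult_nonneg_nonneg conv_iter_nonneg[OF l f g M] poisson_weight_nonneg l)
    also have "\<dots> \<le> l * g x + \<theta> * g x" by (rule elim)
    finally have 1: "?w 2 * ?c 2 x + (\<Sum>n\<in>{..<N} - {2}. ?w n * ?c n x) \<le> l * g x + \<theta> * g x" .
    have "(\<Sum>n\<in>{..<N} - {2}. ?w n * ((real n - \<theta>) * g x)) \<le> (\<Sum>n\<in>{..<N} - {2}. ?w n * ?c n x)"
      using elim poisson_weight_nonneg[OF l] by (intro sum_mono mult_left_mono) auto
    also have "(\<Sum>n\<in>{..<N} - {2}. ?w n * ((real n - \<theta>) * g x)) =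
        ((\<Sum>n\<in>{..<N} - {2}. ?w n * real n) - (\<Sum>n\<in>{..<N} - {2}. ?w n) * \<theta>) * g x"
      by (simp add: sum_distrib_right sum_subtractf left_diff_distrib right_diff_distrib mult.assoc)
    finally have 2: "((\<Sum>n\<in>{..<N} - {2}. ?w n * real n) - (\<Sum>n\<in>{..<N} - {2}. ?w n) * \<theta>) * g x
        \<le> (\<Sum>n\<in>{..<N} - {2}. ?w n * ?c n x)" .
    have "l - \<theta> - 2 * ?w 2 - \<theta> \<le> (\<Sum>n\<in>{..<N} - {2}. ?w n * real n) - (\<Sum>n\<in>{..<N} - {2}. ?w n) * \<theta>"
    proof -
      have "(\<Sum>n<N. ?w n * real n) = ?w 2 * 2 + (\<Sum>n\<in>{..<N} - {2}. ?w n * real n)"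
        using N(2) by (subst sum.remove[of _ 2]) auto
      moreover have "(\<Sum>n\<in>{..<N} - {2}. ?w n) * \<theta> \<le> 1 * \<theta>" using N1 \<theta> by (intro mult_right_mono) auto
      ultimately show ?thesis using N(1) by linarith
    qed
    from mult_right_mono[OF this gx] 1 2
    have "?w 2 * ?c 2 x \<le> (l + \<theta> - (l - \<theta> - 2 * ?w 2 - \<theta>)) * g x" by (simp add: algebra_simps)
    also have "\<dots> = ?w 2 * ((2 + \<eta>) * g x)" by (simp add: \<theta>_def algebra_simps)
    finally have "?c 2 x \<le> (2 + \<eta>) * g x" using w2 by simp
    then show ?case
      unfolding conv_on_conv_iter[OF f g M] by (intro ennreal_leI) (simp add: numeral_2_eq_2)
  qed
qed (rule g, rule gL)

end

section \<open>Equivalent conditions for subexponentiality of the mixture\<close>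

lemma tail_equiv_iff_asymp:
  assumes q: "\<forall>\<^sub>F x in at_top. q x > 0" and c: "c > 0"
  shows "tail_equiv a (\<lambda>x. c * q x) \<longleftrightarrow> asymp_ge a c q \<and> asymp_le a c q q"
proof
  assume te: "tail_equiv a (\<lambda>x. c * q x)"
  then have lim: "((\<lambda>x. a x / (c * q x)) \<longlongrightarrow> 1) at_top" by (simp add: tail_equiv_def)
  show "asymp_ge a c q \<and> asymp_le a c q q"
    unfolding asymp_ge_def asymp_le_def
  proof (intro conjI allI impI)
    fix \<beta> assume "\<beta> < c"
    then have "\<forall>\<^sub>F x in at_top. \<beta> / c < a x / (c * q x)"
      using c by (intro order_tendstoD[OF lim]) simp
    then show "\<forall>\<^sub>F x in at_top. \<beta> * q x \<le> a x"
      using q by eventually_elim (use c in \<open>simp add: field_simps\<close>)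
  next
    fix \<eta> :: real assume "\<eta> > 0"
    then have "\<forall>\<^sub>F x in at_top. a x / (c * q x) < 1 + \<eta> / c"
      using c by (intro order_tendstoD[OF lim]) simp
    then show "\<forall>\<^sub>F x in at_top. a x \<le> c * q x + \<eta> * q x"
      using q by eventually_elim (use c in \<open>simp add: field_simps\<close>)
  qed
next
  assume as: "asymp_ge a c q \<and> asymp_le a c q q"
  have "\<forall>\<^sub>F x in at_top. c / 2 * q x \<le> a x"
    using as c unfolding asymp_ge_def by (elim conjE allE[of _ "c / 2"]) auto
  then have "\<forall>\<^sub>F x in at_top. a x > 0 \<and> c * q x > 0"
    using q
  proof eventually_elim
    case (elim x)
    have "0 < c / 2 * q x" using elim c by simp
    also have "\<dots> \<le> a x" by (rule elim)
    finally show ?case using elim c by simp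
  qed
  moreover have "((\<lambda>x. a x / (c * q x)) \<longlongrightarrow> 1) at_top"
  proof (rule order_tendstoI)
    fix y :: real assume y: "y < 1"
    then have "(y + 1) / 2 * c < c" using c by simp
    then have "\<forall>\<^sub>F x in at_top. (y + 1) / 2 * c * q x \<le> a x"
      using as unfolding asymp_ge_def by blast
    then show "\<forall>\<^sub>F x in at_top. y < a x / (c * q x)"
      using q
    proof eventually_elim
      case (elim x)
      have "y * (c * q x) < (y + 1) / 2 * (c * q x)"
        using y c elim by (intro mult_strict_right_mono) auto
      also have "\<dots> \<le> a x" using elim by (simp add: mult.assoc)
      finally show ?case using elim c by (simp add: pos_less_divide_eq)
    qed
  next
    fix y :: real assume y: "y > 1"
    then have "c * (y - 1) / 2 > 0" using c by simp
    then have "\<forall>\<^sub>F x in at_top. a x \<le> c * q x + c * (y - 1) / 2 * q x"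
      using as unfolding asymp_le_def by blast
    then show "\<forall>\<^sub>F x in at_top. a x / (c * q x) < y"
      using q
    proof eventually_elim
      case (elim x)
      have "(y + 1) / 2 * (c * q x) < y * (c * q x)"
        using y c elim by (intro mult_strict_right_mono) auto
      moreover have "a x \<le> (y + 1) / 2 * (c * q x)" using elim by (simp add: field_simps)
      ultimately have "a x < y * (c * q x)" by linarith
      then show ?case using elim c by (simp add: pos_divide_less_eq)
    qed
  qed
  ultimately show "tail_equiv a (\<lambda>x. c * q x)"
    by (auto simp: tail_equiv_def eventually_at_top_linorder)
qed

lemma tail_equivI:
  assumes "\<forall>\<^sub>F x in at_top. a x > 0 \<and> b x > 0" "((\<lambda>x. a x / b x) \<longlongrightarrow> 1) at_top"
  shows "tail_equiv a b"
  using assms by (auto simp: tail_equiv_def eventually_at_top_linorder)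

lemma tail_equivD:
  assumes "tail_equiv a b"
  shows "\<forall>\<^sub>F x in at_top. a x > 0 \<and> b x > 0" "((\<lambda>x. a x / b x) \<longlongrightarrow> 1) at_top"
  using assms by (auto simp: tail_equiv_def eventually_at_top_linorder)

lemma tail_equiv_sym:
  assumes "tail_equiv a b"
  shows "tail_equiv b a"
proof (rule tail_equivI)
  show "\<forall>\<^sub>F x in at_top. b x > 0 \<and> a x > 0"
    using tail_equivD(1)[OF assms] by eventually_elim auto
  have "((\<lambda>x. inverse (a x / b x)) \<longlongrightarrow> inverse 1) at_top"
    by (intro tendsto_inverse tail_equivD(2)[OF assms]) simp
  then show "((\<lambda>x. b x / a x) \<longlongrightarrow> 1) at_top" by simp
qed

lemma tail_equiv_trans:
  assumes "tail_equiv a b" "tail_equiv b c"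
  shows "tail_equiv a c"
proof (rule tail_equivI)
  show "\<forall>\<^sub>F x in at_top. a x > 0 \<and> c x > 0"
    using tail_equivD(1)[OF assms(1)] tail_equivD(1)[OF assms(2)] by eventually_elim auto
  have "((\<lambda>x. (a x / b x) * (b x / c x)) \<longlongrightarrow> 1 * 1) at_top"
    by (intro tendsto_mult tail_equivD(2) assms)
  moreover have "\<forall>\<^sub>F x in at_top. (a x / b x) * (b x / c x) = a x / c x"
    using tail_equivD(1)[OF assms(1)] by eventually_elim auto
  ultimately show "((\<lambda>x. a x / c x) \<longlongrightarrow> 1) at_top"
    using Lim_transform_eventually by fastforce
qed

lemma tail_equiv_shift:
  assumes "tail_equiv a b"
  shows "tail_equiv (\<lambda>x. a (x + t)) (\<lambda>x. b (x + t))"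
proof (rule tail_equivI)
  have sh: "filterlim (\<lambda>x. x + t) at_top at_top"
    by (subst add.commute) (rule filterlim_tendsto_add_at_top[OF tendsto_const filterlim_ident])
  show "\<forall>\<^sub>F x in at_top. a (x + t) > 0 \<and> b (x + t) > 0"
    by (rule eventually_compose_filterlim[OF tail_equivD(1)[OF assms] sh])
  show "((\<lambda>x. a (x + t) / b (x + t)) \<longlongrightarrow> 1) at_top"
    by (rule filterlim_compose[OF tail_equivD(2)[OF assms] sh])
qed

lemma tail_equiv_cmult: "tail_equiv a b \<Longrightarrow> c > 0 \<Longrightarrow> tail_equiv (\<lambda>x. c * a x) (\<lambda>x. c * b x)"
  unfolding tail_equiv_def by (simp add: zero_less_mult_iff)

text \<open>Follow the chain \<open>p (x + t) \<sim> c * g (x + t) \<sim> c * g x \<sim> p x\<close>.\<close>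

lemma long_tailed_if_tail_equiv:
  assumes g: "long_tailed g" and p: "halfline_density p"
    and te: "tail_equiv p (\<lambda>x. c * g x)" and c: "c > 0"
  shows "long_tailed p"
  unfolding long_tailed_def
proof (intro conjI allI)
  fix t
  have "tail_equiv (\<lambda>x. g (x + t)) g" using g by (simp add: long_tailed_def)
  from tail_equiv_trans[OF tail_equiv_trans[OF tail_equiv_shift[OF te, of t] tail_equiv_cmult[OF this c]]
      tail_equiv_sym[OF te]]
  show "tail_equiv (\<lambda>x. p (x + t)) p" .
qed (use halfline_densityD[OF p] in auto)

lemma halfline_density_imp_prob_density:
  assumes "halfline_density q"
  shows "prob_density q"
  unfolding prob_density_def is_density_of_def
  using halfline_density_prob_space[OF assms] halfline_densityD[OF assms] by blast

text \<open>The two ends of the self-convolution always contribute \<open>2 * q x\<close> asymptotically.\<close>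

lemma subexp_density_iff_mid_small:
  assumes q: "halfline_density q" and qL: "long_tailed q"
  shows "subexp_density q \<longleftrightarrow> mid_small q"
proof -
  have pos: "\<forall>\<^sub>F x in at_top. q x > 0" by (rule long_tailedD(3)[OF qL])
  have q1: "asymp_ge q 1 q" by (rule asymp_ge_refl) (rule long_tailedD(2)[OF qL])
  have q2: "asymp_le q 1 q q"
    unfolding asymp_le_def using halfline_densityD(2)[OF q] by (auto intro!: always_eventually)
  have "subexp_density q \<longleftrightarrow> tail_equiv (density_conv q q) (\<lambda>x. 2 * q x)"
    using halfline_density_imp_prob_density[OF q] qL
    by (simp add: subexp_density_def long_tailed_density_def)
  also have "\<dots> \<longleftrightarrow> mid_small q"
  proof
    assume te: "tail_equiv (density_conv q q) (\<lambda>x. 2 * q x)"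
    then have le: "asymp_le (density_conv q q) 2 q q"
      using tail_equiv_iff_asymp[OF pos, of 2] by simp
    show "mid_small q"
    proof (rule mid_small_if_conv_le[OF q q1 q q1 qL])
      fix \<eta> :: real assume "\<eta> > 0"
      with le have "\<forall>\<^sub>F x in at_top. density_conv q q x \<le> 2 * q x + \<eta> * q x"
        unfolding asymp_le_def by blast
      then show "\<forall>\<^sub>F x in at_top. conv_on UNIV q q x \<le> ennreal ((2 + \<eta>) * q x)"
        using tail_equivD(1)[OF te]
      proof eventually_elim
        case (elim x)
        \<comment> \<open>An infinite convolution would have the real value 0, which is excluded by positivity.\<close>
        then have "conv_on UNIV q q x < top"
          unfolding density_conv_eq_conv_on[OF q q] by (simp add: enn2real_positive_iff)
        then have "conv_on UNIV q q x = ennreal (density_conv q q x)"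
          unfolding density_conv_eq_conv_on[OF q q] by simp
        then show ?case using elim by (auto intro!: ennreal_leI simp: algebra_simps)
      qed
    qed
  next
    assume mid: "mid_small q"
    have up: "\<forall>\<^sub>F x in at_top. conv_on UNIV q q x \<le> ennreal ((1 + 1) * q x + \<eta> * q x)" if "\<eta> > 0" for \<eta>
      by (rule conv_upper[where K = 1]) (use q q2 qL mid that in auto)
    have "asymp_le (density_conv q q) 2 q q"
      unfolding asymp_le_def
    proof (intro allI impI)
      fix \<eta> :: real assume \<eta>: "\<eta> > 0"
      from up[OF this] show "\<forall>\<^sub>F x in at_top. density_conv q q x \<le> 2 * q x + \<eta> * q x"
      proof eventually_elim
        case (elim x)
        then have "enn2real (conv_on UNIV q q x) \<le> (1 + 1) * q x + \<eta> * q x"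
          using \<eta> halfline_densityD(2)[OF q] by (intro enn2real_leI) auto
        then show ?case unfolding density_conv_eq_conv_on[OF q q] by simp
      qed
    qed
    moreover have "asymp_ge (density_conv q q) 2 q"
      unfolding asymp_ge_def
    proof (intro allI impI)
      fix \<beta> :: real assume "\<beta> < 2"
      then have "\<forall>\<^sub>F x in at_top. ennreal (\<beta> * q x) \<le> conv_on UNIV q q x"
        by (intro conv_lower[OF q q1 q q1 qL]) simp
      then show "\<forall>\<^sub>F x in at_top. \<beta> * q x \<le> density_conv q q x"
        using up[OF zero_less_one]
      proof eventually_elim
        case (elim x)
        then have "conv_on UNIV q q x < top" by (simp add: order_le_less_trans)
        then have "conv_on UNIV q q x = ennreal (density_conv q q x)"
          unfolding density_conv_eq_conv_on[OF q q] by simp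
        moreover have "density_conv q q x \<ge> 0" by (simp add: density_conv_eq_conv_on[OF q q])
        ultimately show ?case using elim by (simp add: ennreal_le_iff)
      qed
    qed
    ultimately show "tail_equiv (density_conv q q) (\<lambda>x. 2 * q x)"
      using tail_equiv_iff_asymp[OF pos, of 2] by simp
  qed
  finally show ?thesis .
qed

lemma mid_small_if_tail_equiv:
  assumes gL: "long_tailed g" and p: "halfline_density p"
    and te: "tail_equiv p (\<lambda>x. c * g x)" and c: "c > 0" and g: "mid_small g"
  shows "mid_small p"
  unfolding mid_small_def
proof (intro allI impI)
  fix \<eta> :: real assume \<eta>: "\<eta> > 0"
  note [measurable] = halfline_densityD(1)[OF p] long_tailedD(1)[OF gL]
  have ge: "asymp_ge p c g" and le: "asymp_le p c g g"
    using te tail_equiv_iff_asymp[OF long_tailedD(3)[OF gL] c] by auto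
  have "\<forall>\<^sub>F x in at_top. p x \<le> c * g x + c * g x"
    using le c unfolding asymp_le_def by blast
  then obtain Y where Y: "\<And>x. x \<ge> Y \<Longrightarrow> p x \<le> 2 * c * g x"
    unfolding eventually_at_top_linorder by (metis mult.commute mult_2_right mult.left_commute)
  define \<eta>' where "\<eta>' = \<eta> / (8 * c)"
  have \<eta>': "\<eta>' > 0" using \<eta> c by (simp add: \<eta>'_def)
  then obtain A0 where A0: "\<And>A. A \<ge> A0 \<Longrightarrow>
      \<forall>\<^sub>F x in at_top. conv_on {A..x - A} g g x \<le> ennreal (\<eta>' * g x)"
    using g unfolding mid_small_def by blast
  have lower: "\<forall>\<^sub>F x in at_top. c / 2 * g x \<le> p x"
    using ge c unfolding asymp_ge_def by (elim allE[of _ "c / 2"]) auto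
  show "\<exists>A0. \<forall>A\<ge>A0. \<forall>\<^sub>F x in at_top. conv_on {A..x - A} p p x \<le> ennreal (\<eta> * p x)"
  proof (rule exI[of _ "max A0 Y"], intro allI impI)
    fix A assume A: "max A0 Y \<le> A"
    then have "\<forall>\<^sub>F x in at_top. conv_on {A..x - A} g g x \<le> ennreal (\<eta>' * g x)" by (intro A0) auto
    then show "\<forall>\<^sub>F x in at_top. conv_on {A..x - A} p p x \<le> ennreal (\<eta> * p x)"
      using lower
    proof eventually_elim
      case (elim x)
      have "conv_on {A..x - A} p p x \<le> ennreal (4 * c^2) * conv_on {A..x - A} g g x"
      proof (rule conv_on_le_cmult)
        fix u assume u: "u \<in> {A..x - A}"
        have "p (x - u) * p u \<le> (2 * c * g (x - u)) * (2 * c * g u)"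
          using u A c halfline_densityD(2)[OF p] long_tailedD(2)[OF gL]
          by (intro mult_mono Y) auto
        then show "p (x - u) * p u \<le> 4 * c^2 * (g (x - u) * g u)"
          by (simp add: power2_eq_square mult_ac)
      qed auto
      also have "\<dots> \<le> ennreal (4 * c^2) * ennreal (\<eta>' * g x)"
        using elim by (intro mult_left_mono) auto
      also have "\<dots> = ennreal (4 * c^2 * (\<eta>' * g x))" by (simp add: ennreal_mult')
      also have "4 * c^2 * (\<eta>' * g x) = \<eta> * (c / 2 * g x)"
        using c by (simp add: \<eta>'_def power2_eq_square field_simps)
      also have "ennreal \<dots> \<le> ennreal (\<eta> * p x)"
        using elim \<eta> by (intro ennreal_leI mult_left_mono) auto
      finally show ?case .
    qed
  qed
qed

lemma exp_light_asymp_le: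
  assumes lim: "((\<lambda>x. exp (b * x) * f x) \<longlongrightarrow> 0) at_top" and b: "b > 0" and q: "long_tailed q"
  shows "asymp_le f 0 g q"
  unfolding asymp_le_def
proof (intro allI impI)
  fix \<eta> :: real assume \<eta>: "\<eta> > 0"
  obtain c where c: "c > 0" "\<forall>\<^sub>F x in at_top. c * exp (- b * x) \<le> q x"
    using long_tailed_lower_exp[OF q b] by auto
  have "\<forall>\<^sub>F x in at_top. exp (b * x) * f x < \<eta> * c"
    using \<eta> c by (intro order_tendstoD[OF lim]) auto
  then show "\<forall>\<^sub>F x in at_top. f x \<le> 0 * g x + \<eta> * q x"
    using c(2)
  proof eventually_elim
    case (elim x)
    have "f x = exp (- b * x) * (exp (b * x) * f x)" by (simp flip: exp_add mult.assoc)
    also have "\<dots> \<le> exp (- b * x) * (\<eta> * c)" using elim by (intro mult_left_mono) auto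
    also have "\<dots> = \<eta> * (c * exp (- b * x))" by simp
    also have "\<dots> \<le> \<eta> * q x" using elim \<eta> by (intro mult_left_mono) auto
    finally show ?case by simp
  qed
qed

lemma exp_light_integrable:
  assumes f: "halfline_density f" and lim: "((\<lambda>x. exp (b * x) * f x) \<longlongrightarrow> 0) at_top" and b: "b > 0"
  shows "integrable lborel (\<lambda>x. f x * exp (b / 2 * x))"
proof -
  note [measurable] = halfline_densityD(1)[OF f]
  have "\<forall>\<^sub>F x in at_top. exp (b * x) * f x < 1" by (intro order_tendstoD[OF lim]) auto
  then obtain X0 where X0: "\<And>x. x \<ge> X0 \<Longrightarrow> exp (b * x) * f x < 1"
    unfolding eventually_at_top_linorder by blast
  define X where "X = max 0 X0"
  interpret E: prob_space "density lborel (exponential_density (b / 2))"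
    by (rule prob_space_exponential_density) (use b in simp)
  have "integrable lborel (exponential_density (b / 2))"
    using E.emeasure_space_1 b
    by (intro integrableI_nonneg) (auto simp: emeasure_density exponential_density_nonneg)
  then have int: "integrable lborel (\<lambda>x. exp (b / 2 * X) * f x + 2 / b * exponential_density (b / 2) x)"
    using halfline_density_integral(2)[OF f] by auto
  show ?thesis
  proof (rule Bochner_Integration.integrable_bound[OF int])
    show "AE x in lborel. norm (f x * exp (b / 2 * x)) \<le>
        norm (exp (b / 2 * X) * f x + 2 / b * exponential_density (b / 2) x)"
    proof (rule AE_I2)
      fix x
      have nn: "0 \<le> exp (b / 2 * X) * f x" "0 \<le> 2 / b * exponential_density (b / 2) x"
        using b halfline_densityD(2)[OF f] by (auto simp: exponential_density_nonneg)
      have "f x * exp (b / 2 * x) \<le> exp (b / 2 * X) * f x + 2 / b * exponential_density (b / 2) x"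
      proof (cases "x < X")
        case True
        then have "f x * exp (b / 2 * x) \<le> f x * exp (b / 2 * X)"
          using b halfline_densityD(2)[OF f] by (intro mult_left_mono) auto
        then show ?thesis using nn by (simp add: mult.commute)
      next
        case False
        have "f x * exp (b / 2 * x) = exp (b * x) * f x * exp (- (b / 2) * x)"
          by (simp add: mult_ac flip: exp_add)
        also have "\<dots> \<le> 1 * exp (- (b / 2) * x)"
          using X0[of x] False by (intro mult_right_mono) (auto simp: X_def not_less less_imp_le)
        also have "\<dots> = 2 / b * exponential_density (b / 2) x"
          using False b by (simp add: exponential_density_def X_def mult.commute)
        finally show ?thesis using nn by linarith
      qed
      then show "norm (f x * exp (b / 2 * x)) \<le>
          norm (exp (b / 2 * X) * f x + 2 / b * exponential_density (b / 2) x)"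
        using nn halfline_densityD(2)[OF f, of x] by (simp add: abs_mult)
    qed
  qed measurable
qed

text \<open>Always \<open>liminf p / g \<ge> l\<close>, so that \<open>p \<sim> l * g\<close> amounts to the upper bound \<open>p \<le> l * g +
  o(g)\<close>. If \<open>g\<close> is subexponential, this is the upper bound for the mixture on the scale \<open>g\<close>. If
  \<open>p\<close> is subexponential, the same bound on the scale \<open>p\<close> applies, since \<open>g\<close> is of the order of
  \<open>p\<close> at most; it gives \<open>p \<le> l * g + o(p)\<close>, which still makes \<open>g / p\<close> tend to \<open>1 / l\<close>. If \<open>p \<sim> C
  * g\<close>, then \<open>C \<le> l\<close> by the comparison of weighted masses, so the upper bound holds and \<open>g\<close> is
  subexponential. Subexponentiality of \<open>p\<close> then follows by transfer along \<open>p \<sim> l * g\<close>.\<close>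

theorem poisson_mixture_subexp_equivalences:
  fixes l M b :: real and f g :: "real \<Rightarrow> real"
  defines "p \<equiv> poisson_mixture l f g"
  assumes l: "l > 0" and f: "halfline_density f" and g: "halfline_density g"
    and M: "\<And>x. g x \<le> M" and gL: "long_tailed g"
    and b: "b > 0" and lim: "((\<lambda>x. exp (b * x) * f x) \<longlongrightarrow> 0) at_top"
  shows "subexp_density p \<longleftrightarrow> subexp_density g"
    and "subexp_density g \<longleftrightarrow> tail_equiv p (\<lambda>x. l * g x)"
    and "tail_equiv p (\<lambda>x. l * g x) \<longleftrightarrow> (\<exists>C>0. tail_equiv p (\<lambda>x. C * g x))"
proof -
  have l0: "l \<ge> 0" using l by simp
  have p: "halfline_density p" unfolding p_def by (rule halfline_density_poisson_mixture[OF l0 f g M])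
  have pos: "\<forall>\<^sub>F x in at_top. g x > 0" by (rule long_tailedD(3)[OF gL])
  have p_ge: "asymp_ge p l g" unfolding p_def by (rule poisson_mixture_asymp_ge[OF l0 f g M gL])
  have equiv_iff: "tail_equiv p (\<lambda>x. l * g x) \<longleftrightarrow> asymp_le p l g g"
    using tail_equiv_iff_asymp[OF pos l] p_ge by simp
  have 23: "tail_equiv p (\<lambda>x. l * g x)" if "subexp_density g"
  proof -
    have "mid_small g" using that subexp_density_iff_mid_small[OF g gL] by simp
    then have "asymp_le p l g g"
      unfolding p_def
      by (intro poisson_mixture_asymp_le[where K = 1 and M = M] l0 f g M gL exp_light_asymp_le[OF lim b gL]) auto
    then show ?thesis by (simp add: equiv_iff)
  qed
  have 13: "tail_equiv p (\<lambda>x. l * g x)" if "subexp_density p"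
  proof -
    have pL: "long_tailed p" using that by (simp add: subexp_density_def long_tailed_density_def)
    have mid: "mid_small p" using that subexp_density_iff_mid_small[OF p pL] by simp
    have "\<forall>\<^sub>F x in at_top. l / 2 * g x \<le> p x"
      using p_ge l unfolding asymp_ge_def by (elim allE[of _ "l / 2"]) auto
    then have gp: "\<forall>\<^sub>F x in at_top. g x \<le> 2 / l * p x"
      by eventually_elim (use l in \<open>simp add: field_simps\<close>)
    have "asymp_le p l g p"
      unfolding p_def
      by (rule poisson_mixture_asymp_le[where K = "2 / l" and M = M])
         (use l l0 f g M gL p mid pL gp exp_light_asymp_le[OF lim b pL] in \<open>auto simp: p_def\<close>)
    have le: "asymp_le g (1 / l) p p"
      unfolding asymp_le_def
    proof (intro allI impI)
      fix \<eta> :: real assume \<eta>: "\<eta> > 0"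
      define \<beta> where "\<beta> = l / (1 + \<eta> * l)"
      have "1 < 1 + \<eta> * l" using l \<eta> by simp
      then have \<beta>: "\<beta> < l" "0 < \<beta>" "1 / \<beta> = 1 / l + \<eta>"
        using l by (auto simp: \<beta>_def divide_less_eq add_divide_distrib)
      then have "\<forall>\<^sub>F x in at_top. \<beta> * g x \<le> p x" using p_ge unfolding asymp_ge_def by blast
      then show "\<forall>\<^sub>F x in at_top. g x \<le> 1 / l * p x + \<eta> * p x"
      proof eventually_elim
        case (elim x)
        then have "g x \<le> 1 / \<beta> * p x" using \<beta>(2) by (simp add: field_simps)
        then show ?case unfolding \<beta>(3) by (simp add: algebra_simps)
      qed
    qed
    have ge: "asymp_ge g (1 / l) p"
      unfolding asymp_ge_def
    proof (intro allI impI)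
      fix \<beta> assume \<beta>: "\<beta> < 1 / l"
      define \<eta> where "\<eta> = 1 - l * \<beta>"
      have "\<eta> > 0" using \<beta> l by (simp add: \<eta>_def field_simps)
      then have "\<forall>\<^sub>F x in at_top. p x \<le> l * g x + \<eta> * p x"
        using \<open>asymp_le p l g p\<close> unfolding asymp_le_def by blast
      then show "\<forall>\<^sub>F x in at_top. \<beta> * p x \<le> g x"
      proof eventually_elim
        case (elim x)
        then have "l * (\<beta> * p x) \<le> l * g x" by (simp add: \<eta>_def algebra_simps)
        then show ?case using l by simp
      qed
    qed
    have "tail_equiv g (\<lambda>x. 1 / l * p x)"
      using ge le l tail_equiv_iff_asymp[OF long_tailedD(3)[OF pL], of "1 / l" g] by simp
    from tail_equiv_sym[OF tail_equiv_cmult[OF this l]] show ?thesis using l by simp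
  qed
  have 42: "subexp_density g" if C: "C > 0" "tail_equiv p (\<lambda>x. C * g x)" for C
  proof -
    have "asymp_ge p C g" "asymp_le p C g g"
      using C tail_equiv_iff_asymp[OF pos C(1)] by auto
    have "C \<le> l"
      using poisson_mixture_ratio_le[OF l0 f g M gL _ exp_light_integrable[OF f lim b]]
        \<open>asymp_ge p C g\<close> b unfolding p_def by simp
    have "asymp_le p l g g"
      unfolding asymp_le_def
    proof (intro allI impI)
      fix \<eta> :: real assume "\<eta> > 0"
      with \<open>asymp_le p C g g\<close> have "\<forall>\<^sub>F x in at_top. p x \<le> C * g x + \<eta> * g x"
        unfolding asymp_le_def by blast
      then show "\<forall>\<^sub>F x in at_top. p x \<le> l * g x + \<eta> * g x"
      proof eventually_elim
        case (elim x)
        have "C * g x \<le> l * g x"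
          using \<open>C \<le> l\<close> halfline_densityD(2)[OF g] by (rule mult_right_mono)
        with elim show ?case by linarith
      qed
    qed
    then have "mid_small g"
      unfolding p_def by (rule mid_small_if_poisson_mixture_le[OF l0 f g M gL l])
    then show ?thesis using subexp_density_iff_mid_small[OF g gL] by simp
  qed
  have 21: "subexp_density p" if "subexp_density g"
  proof -
    have te: "tail_equiv p (\<lambda>x. l * g x)" by (rule 23[OF that])
    have pL: "long_tailed p" by (rule long_tailed_if_tail_equiv[OF gL p te l])
    have "mid_small g" using that subexp_density_iff_mid_small[OF g gL] by simp
    then have "mid_small p" by (rule mid_small_if_tail_equiv[OF gL p te l])
    then show ?thesis using subexp_density_iff_mid_small[OF p pL] by simp
  qed
  show "subexp_density p \<longleftrightarrow> subexp_density g"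
    and "subexp_density g \<longleftrightarrow> tail_equiv p (\<lambda>x. l * g x)"
    and "tail_equiv p (\<lambda>x. l * g x) \<longleftrightarrow> (\<exists>C>0. tail_equiv p (\<lambda>x. C * g x))"
    using 13 23 42 21 l by blast+
qed

section \<open>Identification of the infinitely divisible law\<close>

lemma char_convolution:
  assumes M: "real_distribution M" and N: "real_distribution N"
  shows "char (convolution M N) t = char M t * char N t"
proof -
  interpret M: real_distribution M by (rule M)
  interpret N: real_distribution N by (rule N)
  interpret P: pair_prob_space M N ..
  have int: "integrable (M \<Otimes>\<^sub>M N) (\<lambda>(x, y). iexp (t * (x + y)))"
    by (rule P.integrable_const_bound[where B = 1]) auto
  have "char (convolution M N) t = integral\<^sup>L (M \<Otimes>\<^sub>M N) (\<lambda>z. iexp (t * (case z of (x, y) \<Rightarrow> x + y)))"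
    unfolding char_def convolution_def by (subst integral_distr) auto
  also have "\<dots> = (CLINT x|M. CLINT y|N. iexp (t * (x + y)))"
    using P.integral_fst'[OF int] by (simp add: case_prod_beta')
  also have "\<dots> = (CLINT x|M. iexp (t * x) * (CLINT y|N. iexp (t * y)))"
    by (simp add: distrib_left exp_add)
  also have "\<dots> = char M t * char N t" by (simp add: char_def)
  finally show ?thesis .
qed

lemma halfline_density_real_distribution:
  assumes "halfline_density a"
  shows "real_distribution (density lborel (\<lambda>x. ennreal (a x)))"
  using halfline_density_prob_space[OF assms]
  by (intro real_distribution.intro real_distribution_axioms.intro) auto

lemma char_density:
  assumes "halfline_density a"
  shows "char (density lborel (\<lambda>x. ennreal (a x))) t = (CLINT x|lborel. a x *\<^sub>R iexp (t * x))"
  using halfline_densityD[OF assms] unfolding char_def by (subst integral_density) auto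

text \<open>The characteristic functions of the \<open>n\<close>-fold terms are \<open>\<phi> * \<psi> ^ n\<close>, and the Poisson
  generating function, now at the complex argument \<open>\<psi>\<close>, sums them up.\<close>

lemma char_poisson_mixture:
  assumes l: "l \<ge> 0" and f: "halfline_density f" and g: "halfline_density g" and M: "\<And>x. g x \<le> M"
  shows "char (density lborel (\<lambda>x. ennreal (poisson_mixture l f g x))) t =
    char (density lborel (\<lambda>x. ennreal (f x))) t *
    exp (complex_of_real l * (char (density lborel (\<lambda>x. ennreal (g x))) t - 1))"
proof -
  define \<phi> where "\<phi> = char (density lborel (\<lambda>x. ennreal (f x))) t"
  define \<psi> where "\<psi> = char (density lborel (\<lambda>x. ennreal (g x))) t"
  let ?c = "conv_iter f g" and ?w = "poisson_weight l"
  note c = halfline_density_conv_iter[OF f g M]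
  note [measurable] = conv_iter_measurable[OF l f g M]
  have char_c: "char (density lborel (\<lambda>x. ennreal (?c n x))) t = \<phi> * \<psi> ^ n" for n
  proof (induction n)
    case 0
    then show ?case by (simp add: \<phi>_def)
  next
    case (Suc n)
    have "char (density lborel (\<lambda>x. ennreal (?c (Suc n) x))) t =
        char (density lborel (\<lambda>x. ennreal (?c n x))) t * \<psi>"
      unfolding conv_iter.simps density_conv_eq_convolution[OF c g M] \<psi>_def
      by (intro char_convolution halfline_density_real_distribution c g)
    then show ?case using Suc by (simp add: mult_ac)
  qed
  have norm_c: "(LINT x|lborel. norm ((?w n * ?c n x) *\<^sub>R iexp (t * x))) = ?w n" for n
    using halfline_density_integral[OF c, of n] halfline_densityD(2)[OF c] poisson_weight_nonneg[OF l]
    by (simp add: abs_mult)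
  have "char (density lborel (\<lambda>x. ennreal (poisson_mixture l f g x))) t =
      (CLINT x|lborel. (\<Sum>n. (?w n * ?c n x) *\<^sub>R iexp (t * x)))"
    by (subst char_density[OF halfline_density_poisson_mixture[OF l f g M]])
       (simp add: poisson_mixture_def suminf_scaleR_left[OF poisson_mixture_summable[OF l f g M]])
  also have "\<dots> = (\<Sum>n. CLINT x|lborel. (?w n * ?c n x) *\<^sub>R iexp (t * x))"
  proof (rule integral_suminf)
    show "integrable lborel (\<lambda>x. (?w n * ?c n x) *\<^sub>R iexp (t * x))" for n
    proof (rule Bochner_Integration.integrable_bound)
      show "integrable lborel (\<lambda>x. ?w n * ?c n x)"
        using halfline_density_integral[OF c, of n] by simp
    qed (auto simp: abs_mult)
    show "AE x in lborel. summable (\<lambda>n. norm ((?w n * ?c n x) *\<^sub>R iexp (t * x)))"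
      using poisson_mixture_summable[OF l f g M] halfline_densityD(2)[OF c] poisson_weight_nonneg[OF l]
      by (intro AE_I2) (simp add: abs_mult)
    show "summable (\<lambda>n. LINT x|lborel. norm ((?w n * ?c n x) *\<^sub>R iexp (t * x)))"
      unfolding norm_c using poisson_weight_sums_1 by (rule sums_summable)
  qed
  also have "\<dots> = (\<Sum>n. \<phi> * (complex_of_real (?w n) * \<psi> ^ n))"
  proof (rule suminf_cong)
    fix n
    have "(CLINT x|lborel. (?w n * ?c n x) *\<^sub>R iexp (t * x)) = ?w n *\<^sub>R (CLINT x|lborel. ?c n x *\<^sub>R iexp (t * x))"
      by (simp flip: scaleR_scaleR del: conv_iter.simps)
    also have "\<dots> = ?w n *\<^sub>R (\<phi> * \<psi> ^ n)"
      using char_c[of n] char_density[OF c, of n t] by simp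
    finally show "(CLINT x|lborel. (?w n * ?c n x) *\<^sub>R iexp (t * x)) = \<phi> * (complex_of_real (?w n) * \<psi> ^ n)"
      by (simp add: scaleR_conv_of_real mult_ac)
  qed
  also have "\<dots> = \<phi> * (exp (- complex_of_real l) * exp (complex_of_real l * \<psi>))"
  proof -
    have "(\<lambda>n. exp (- complex_of_real l) * ((complex_of_real l * \<psi>) ^ n /\<^sub>R fact n)) sums
        (exp (- complex_of_real l) * exp (complex_of_real l * \<psi>))"
      by (intro sums_mult exp_converges)
    also have "(\<lambda>n. exp (- complex_of_real l) * ((complex_of_real l * \<psi>) ^ n /\<^sub>R fact n)) =
        (\<lambda>n. complex_of_real (?w n) * \<psi> ^ n)"
      by (auto simp: poisson_weight_def scaleR_conv_of_real power_mult_distrib field_simps exp_of_real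
          simp flip: of_real_minus)
    finally show ?thesis by (intro sums_unique[symmetric] sums_mult)
  qed
  also have "\<dots> = \<phi> * exp (complex_of_real l * (\<psi> - 1))"
    by (simp add: right_diff_distrib flip: exp_add)
  finally show ?thesis unfolding \<phi>_def \<psi>_def .
qed

lemma norm_iexp_minus_1_le: "norm (iexp y - 1) \<le> \<bar>y\<bar>"
  using iexp_approx1[of y 0] by simp

lemma levy_exponent_integrable:
  assumes \<nu>: "levy_measure_Rplus \<nu>"
  shows "integrable \<nu> (\<lambda>x. iexp (z * x) - 1)"
proof -
  have [measurable_cong]: "sets \<nu> = sets borel" using \<nu> by (simp add: levy_measure_Rplus_def)
  have AE_pos: "AE x in \<nu>. x > 0"
    using \<nu> by (intro AE_I[of _ _ "{..0}"]) (auto simp: levy_measure_Rplus_def)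
  have "integrable \<nu> (\<lambda>x. min 1 x)"
    using \<nu> AE_pos by (intro integrableI_nonneg) (auto simp: levy_measure_Rplus_def)
  then have "integrable \<nu> (\<lambda>x. (2 + \<bar>z\<bar>) * min 1 x)" by simp
  then show ?thesis
  proof (rule Bochner_Integration.integrable_bound)
    show "AE x in \<nu>. norm (iexp (z * x) - 1) \<le> norm ((2 + \<bar>z\<bar>) * min 1 x)"
      using AE_pos
    proof eventually_elim
      case (elim x)
      have "norm (iexp (z * x) - 1) \<le> \<bar>z\<bar> * x"
        using norm_iexp_minus_1_le[of "z * x"] elim by (simp add: abs_mult)
      moreover have "norm (iexp (z * x) - 1) \<le> 2"
        using norm_triangle_ineq4[of "iexp (z * x)" 1] by simp
      ultimately show ?case
        using elim by (cases "x \<le> 1") (auto simp: min_def algebra_simps)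
    qed
  qed measurable
qed

lemma levy_measure_tail_finite:
  assumes \<nu>: "levy_measure_Rplus \<nu>"
  shows "emeasure \<nu> {1<..} < \<infinity>"
proof -
  have [measurable_cong]: "sets \<nu> = sets borel" using \<nu> by (simp add: levy_measure_Rplus_def)
  have "emeasure \<nu> {1<..} = (\<integral>\<^sup>+ x. indicator {1<..} x \<partial>\<nu>)" by simp
  also have "\<dots> \<le> (\<integral>\<^sup>+ x. ennreal (min 1 x) \<partial>\<nu>)"
    by (intro nn_integral_mono) (auto split: split_indicator)
  also have "\<dots> < \<infinity>" using \<nu> by (simp add: levy_measure_Rplus_def)
  finally show ?thesis .
qed

text \<open>The Levy measure has a density, so the point 1 that belongs to neither part has measure 0.
  The part beyond 1 is finite and is rewritten as its mass \<open>l\<close> times a probability measure,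
  which turns its exponent into that of a compound Poisson law.\<close>

lemma levy_exponent_split:
  assumes \<nu>: "levy_measure_Rplus \<nu>" and g: "is_density_of g \<nu>"
    and l: "emeasure \<nu> {1<..} = ennreal l" "l > 0"
  shows "(CLINT x|\<nu>. iexp (z * x) - 1) =
    (CLINT x|restricted_measure \<nu> {0<..<1}. iexp (z * x) - 1) +
    complex_of_real l * (CLINT x|normalized_levy_measure \<nu>. iexp (z * x) - 1)"
proof -
  have \<nu>_sets [measurable_cong]: "sets \<nu> = sets borel" using \<nu> by (simp add: levy_measure_Rplus_def)
  let ?h = "\<lambda>x. iexp (z * x) - 1"
  note int = levy_exponent_integrable[OF \<nu>, of z]
  have AE_pos: "AE x in \<nu>. x > 0"
    using \<nu> by (intro AE_I[of _ _ "{..0}"]) (auto simp: levy_measure_Rplus_def)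
  have AE_1: "AE x in \<nu>. x \<noteq> 1"
  proof -
    have [measurable]: "g \<in> borel_measurable borel" and eq: "\<nu> = density lborel (\<lambda>x. ennreal (g x))"
      using g by (auto simp: is_density_of_def)
    show ?thesis
      unfolding eq by (subst AE_density) (use AE_lborel_singleton[of "1::real"] in auto)
  qed
  have small: "(CLINT x|restricted_measure \<nu> {0<..<1}. ?h x) = (CLINT x|\<nu>. indicator {0<..<1} x *\<^sub>R ?h x)"
  proof -
    have "restricted_measure \<nu> {0<..<1} = density \<nu> (\<lambda>x. ennreal (indicator {0<..<1} x))"
      unfolding restricted_measure_def by (intro arg_cong[where f = "density \<nu>"]) (auto split: split_indicator)
    then show ?thesis by (simp add: integral_density)
  qed
  have large: "(CLINT x|normalized_levy_measure \<nu>. ?h x) = (CLINT x|\<nu>. (indicator {1<..} x / l) *\<^sub>R ?h x)"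
  proof -
    have "normalized_levy_measure \<nu> = density \<nu> (\<lambda>x. ennreal (indicator {1<..} x / l))"
      unfolding normalized_levy_measure_def l(1)
      by (intro arg_cong[where f = "density \<nu>"]) (use l in \<open>auto simp: fun_eq_iff divide_ennreal indicator_def simp flip: ennreal_1\<close>)
    then show ?thesis using l by (simp add: integral_density)
  qed
  have "(CLINT x|\<nu>. ?h x) = (CLINT x|\<nu>. indicator {0<..<1} x *\<^sub>R ?h x + indicator {1<..} x *\<^sub>R ?h x)"
    by (rule integral_cong_AE) (use AE_pos AE_1 in \<open>auto split: split_indicator\<close>)
  also have "\<dots> = (CLINT x|\<nu>. indicator {0<..<1} x *\<^sub>R ?h x) + (CLINT x|\<nu>. indicator {1<..} x *\<^sub>R ?h x)"
    by (intro Bochner_Integration.integral_add integrable_mult_indicator int) auto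
  also have "(CLINT x|\<nu>. indicator {1<..} x *\<^sub>R ?h x) =
      complex_of_real l * (CLINT x|\<nu>. (indicator {1<..} x / l) *\<^sub>R ?h x)"
    using l by (subst integral_mult_right_zero[symmetric]) (simp add: scaleR_conv_of_real)
  finally show ?thesis unfolding small large .
qed

lemma halfline_densityI:
  assumes "is_density_on_Rplus_of h M" "prob_space M"
  shows "halfline_density h"
proof -
  have "emeasure M UNIV = 1"
    using prob_space.emeasure_space_1[OF assms(2)] assms(1)
    by (auto simp: is_density_on_Rplus_of_def is_density_of_def)
  then show ?thesis
    using assms(1)
    by (auto simp: is_density_on_Rplus_of_def is_density_of_def halfline_density_def emeasure_density)
qed

theorem theorem1p1:
  fixes \<mu> \<nu> \<mu>\<^sub>1 :: "real measure" and g g\<^sub>1 f\<^sub>1 :: "real \<Rightarrow> real" and b\<^sub>0 :: real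
  assumes mu: "inf_div_Rplus \<mu> 0 \<nu>"
    and nu_ac: "is_density_of g \<nu>"
    and nu_inf: "emeasure \<nu> {0<..<1} = \<infinity>"
    and nu_tail: "\<And>c. c > 0 \<Longrightarrow> emeasure \<nu> {c<..} > 0"
    and g1: "is_density_on_Rplus_of g\<^sub>1 (normalized_levy_measure \<nu>)"
    and mu1: "inf_div_Rplus \<mu>\<^sub>1 0 (restricted_measure \<nu> {0<..<1})"
    and f1: "is_density_on_Rplus_of f\<^sub>1 \<mu>\<^sub>1"
    and b0: "b\<^sub>0 > 0"
    and f1_lim: "((\<lambda>x. exp (b\<^sub>0 * x) * f\<^sub>1 x) \<longlongrightarrow> 0) at_top"
    and g1_bdd: "bounded (range g\<^sub>1)"
    and g1_L: "long_tailed_density g\<^sub>1"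
  shows "\<exists>p. is_density_on_Rplus_of p \<mu> \<and>
           (subexp_density p \<longleftrightarrow> subexp_density g\<^sub>1) \<and>
           (subexp_density g\<^sub>1 \<longleftrightarrow> tail_equiv p (\<lambda>x. (LBINT y:{1<..}. g y) * g\<^sub>1 x)) \<and>
           (tail_equiv p (\<lambda>x. (LBINT y:{1<..}. g y) * g\<^sub>1 x) \<longleftrightarrow>
              (\<exists>C>0. tail_equiv p (\<lambda>x. C * g\<^sub>1 x)))"
proof -
  have levy: "levy_measure_Rplus \<nu>" using mu by (simp add: inf_div_Rplus_def)
  define l where "l = enn2real (emeasure \<nu> {1<..})"
  have l: "emeasure \<nu> {1<..} = ennreal l" and l_pos: "l > 0"
    using levy_measure_tail_finite[OF levy] nu_tail[of 1]
    by (auto simp: l_def enn2real_positive_iff)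
  have [measurable]: "g \<in> borel_measurable borel" and g0: "\<And>x. g x \<ge> 0"
    and \<nu>_eq: "\<nu> = density lborel (\<lambda>x. ennreal (g x))"
    using nu_ac by (auto simp: is_density_of_def)
  have C0: "(LBINT y:{1<..}. g y) = l"
  proof -
    have "(LBINT y:{1<..}. g y) = enn2real (\<integral>\<^sup>+ y. ennreal (g y) * indicator {1<..} y \<partial>lborel)"
      unfolding set_lebesgue_integral_def using g0
      by (subst integral_eq_nn_integral)
         (auto intro!: arg_cong[where f = enn2real] nn_integral_cong split: split_indicator)
    then show ?thesis by (simp add: l_def \<nu>_eq emeasure_density)
  qed
  obtain N where N: "prob_space N" "is_density_of g\<^sub>1 N"
    using g1_L by (auto simp: long_tailed_density_def prob_density_def)
  then have g1_eq: "normalized_levy_measure \<nu> = N"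
    using g1 by (simp add: is_density_on_Rplus_of_def is_density_of_def)
  have g: "halfline_density g\<^sub>1" using halfline_densityI[OF g1] N(1) g1_eq by simp
  have mu_dist: "real_distribution \<mu>" "real_distribution \<mu>\<^sub>1"
    using mu mu1 by (auto simp: inf_div_Rplus_def infinitely_divisible_def)
  have f: "halfline_density f\<^sub>1"
    by (rule halfline_densityI[OF f1]) (use mu_dist in \<open>simp add: real_distribution_def\<close>)
  obtain M where M: "\<And>x. g\<^sub>1 x \<le> M"
    using g1_bdd unfolding bounded_iff by (metis abs_le_D1 rangeI real_norm_def)
  have gL: "long_tailed g\<^sub>1" using g1_L by (simp add: long_tailed_density_def)
  define p where "p = poisson_mixture l f\<^sub>1 g\<^sub>1"
  have l0: "l \<ge> 0" using l_pos by simp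
  have p: "halfline_density p" unfolding p_def by (rule halfline_density_poisson_mixture[OF l0 f g M])
  have "\<mu> = density lborel (\<lambda>x. ennreal (p x))"
  \<comment> \<open>Both sides have the characteristic function \<open>char \<mu>\<^sub>1 z\<close> times that of the compound Poisson
    law of the jumps exceeding 1.\<close>
  proof (rule Levy_uniqueness[OF mu_dist(1) halfline_density_real_distribution[OF p]], rule ext)
    fix z
    have \<mu>1_eq: "\<mu>\<^sub>1 = density lborel (\<lambda>x. ennreal (f\<^sub>1 x))"
      and \<nu>1_eq: "normalized_levy_measure \<nu> = density lborel (\<lambda>x. ennreal (g\<^sub>1 x))"
      using f1 g1 by (auto simp: is_density_on_Rplus_of_def is_density_of_def)
    interpret N: real_distribution "normalized_levy_measure \<nu>"
      unfolding \<nu>1_eq by (rule halfline_density_real_distribution[OF g])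
    have "(CLINT x|normalized_levy_measure \<nu>. iexp (z * x) - 1) = char (normalized_levy_measure \<nu>) z - 1"
      unfolding char_def by (subst Bochner_Integration.integral_diff) (use N.prob_space in \<open>auto intro: N.integrable_iexp\<close>)
    then have "char \<mu> z = char \<mu>\<^sub>1 z * exp (complex_of_real l * (char (normalized_levy_measure \<nu>) z - 1))"
      using mu mu1 levy_exponent_split[OF levy nu_ac l l_pos, of z]
      by (simp add: inf_div_Rplus_def exp_add)
    then show "char \<mu> z = char (density lborel (\<lambda>x. ennreal (p x))) z"
      unfolding p_def char_poisson_mixture[OF l0 f g M] by (simp add: \<mu>1_eq \<nu>1_eq)
  qed
  then have "is_density_on_Rplus_of p \<mu>"
    using halfline_densityD[OF p] by (simp add: is_density_on_Rplus_of_def is_density_of_def)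
  then show ?thesis
    using poisson_mixture_subexp_equivalences[OF l_pos f g M gL b0 f1_lim] unfolding C0 p_def by blast
qed

end
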